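(* Let $f,U,K,r$ be as in the context. If $k_0>0$, then the optimal consumption $c$ (that is, the consumption in the optimal pair $(k,c)$ for the problem of maximising $J_\infty(c)$ over $(k,c)\in\mathcal A(K)$) is bounded from above and below on every bounded interval, i.e., for every $T>0$ there exist two constants $0<c_-(T)<c_+(T)<\infty$, depending only on $f,U,k_0$ and $T$, such that $c(t)\in[c_-(T),c_+(T)]$ for every $t\in[0,T]$.
   Context: $\mathbb R_+=[0,\infty)$. $\mathcal M_{loc}(\mathbb R_+)$ is the space of real-valued Radon measures on $\mathbb R_+$, and $BV_{loc}(\mathbb R_+)$ is the space of functions that, on every compact interval $I\subset\mathbb R_+$, are in $L^1(I)$ with distributional derivative a finite Radon measure on $I$. Assumptions on $f$. $\bar I\subset\mathbb R_+$ is a fixed interval (in which the externalities $K$ take their values), and the net output function $f$, $(k,K)\mapsto f(k,K)$, satisfies: (i) $f$ is continuous on $\mathbb R_+\times\mathbb R_+$ and $f(0,K)=0$ for every $K\in\bar I$; (ii) $f$ is $C^1$ on $(0,+\infty)\times(0,+\infty)$, with partial derivatives denoted $f_k,f_K$; (iii) there exists a constant $\delta>0$ such that $f_k\ge-\delta$, and moreover $f_k$ is bounded from above on any set of the form $[a,\infty)\times[0,b]$, for $a>0$ and $b>0$; (iv) for every $M$ there is $\bar k(M)$ such that $f(k,K)\le0$ for every $K\le M$ and $k\ge\bar k(M)$; moreover $\bar k(M)=o(M)$ as $M\to\infty$; (v) there exists $k_1>0$ such that $f(k,K)>0$ for arbitrary $K\in\bar I$ and $0<k<k_1$; (vi) $k\mapsto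 f(k,K)$ is strictly concave for every $K\in\bar I$. Assumptions on $U$. The utility function $U:\mathbb R_+\to\mathbb R_+$ is concave and strictly increasing, with $U'(0)=\infty$ and $U'(\infty)=0$. The discount rate is $r>0$. $K:\mathbb R_+\to(0,\infty)$ is a given bounded function, with values in $\bar I$. For fixed $k_0\in\mathbb R_+$, $\mathcal A(K)$ is the set of pairs $(k,c)$ with $k\in BV_{loc}(\mathbb R_+)$, $c\in\mathcal M_{loc}(\mathbb R_+)$, $k\ge0$, $k(0)=k_0$, $c\ge0$ and $k'+c\le f(k,K)$, the last being an inequality between measures (the right-hand side is the measure on $\mathbb R_+$ with density $f(k(\cdot),K(\cdot))$). For nonnegative $c\in\mathcal M_{loc}(\mathbb R_+)$, $J_\infty(c)=\int_0^\infty e^{-rt}U(c^{ac}(t))\,dt$, where $c^{ac}$ is the density of the absolutely continuous part of $c$ with respect to Lebesgue measure. The optimal pair is unique and its consumption $c$ belongs to $L^1_{loc}(\mathbb R_+)$.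
   Formalization: The constants c_-(T), c_+(T) may depend, besides f, U, k_0 and T, on the discount rate r, the interval \bar I and an upper bound M of K (M = sup \bar I if bounded); without r, or without M for unbounded \bar I, the claim is false. *)

theory Defs
  imports "HOL-Analysis.Analysis" "HOL-Library.Landau_Symbols"
begin

section \<open>Data of the problem\<close>

definition strictly_concave_on :: "real set \<Rightarrow> (real \<Rightarrow> real) \<Rightarrow> bool" where
  "strictly_concave_on S g \<longleftrightarrow>
     convex S \<and>
     (\<forall>x\<in>S. \<forall>y\<in>S. \<forall>u. x \<noteq> y \<and> 0 < u \<and> u < 1 \<longrightarrow>
        u * g x + (1 - u) * g y < g (u * x + (1 - u) * y))"

definition partial_k :: "(real \<Rightarrow> real \<Rightarrow> real) \<Rightarrow> real \<Rightarrow> real \<Rightarrow> real" where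
  "partial_k f k K = deriv (\<lambda>x. f x K) k"

definition partial_K :: "(real \<Rightarrow> real \<Rightarrow> real) \<Rightarrow> real \<Rightarrow> real \<Rightarrow> real" where
  "partial_K f k K = deriv (\<lambda>y. f k y) K"

text \<open>
  Only the values of \<open>f\<close> on \<open>[0,\<infinity>) \<times> [0,\<infinity>)\<close> matter.  The partial derivatives are only
  available on \<open>(0,\<infinity>) \<times> (0,\<infinity>)\<close>, so the upper bound on \<open>f\<^sub>k\<close> over \<open>[a,\<infinity>) \<times> [0,b]\<close> is
  required at the points of that set with \<open>K > 0\<close>.
\<close>

definition net_output :: "real set \<Rightarrow> (real \<Rightarrow> real \<Rightarrow> real) \<Rightarrow> bool" where
  "net_output I f \<longleftrightarrow>
     continuous_on ({0..} \<times> {0..}) (\<lambda>(k, K). f k K) \<and>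
     (\<forall>K\<in>I. f 0 K = 0) \<and>
     (\<forall>k>0. \<forall>K>0. (\<lambda>x. f x K) differentiable (at k) \<and> (\<lambda>y. f k y) differentiable (at K)) \<and>
     continuous_on ({0<..} \<times> {0<..}) (\<lambda>(k, K). partial_k f k K) \<and>
     continuous_on ({0<..} \<times> {0<..}) (\<lambda>(k, K). partial_K f k K) \<and>
     (\<exists>\<delta>>0. \<forall>k>0. \<forall>K>0. - \<delta> \<le> partial_k f k K) \<and>
     (\<forall>a>0. \<forall>b>0. \<exists>C. \<forall>k\<ge>a. \<forall>K. 0 < K \<and> K \<le> b \<longrightarrow> partial_k f k K \<le> C) \<and>
     (\<exists>kbar :: real \<Rightarrow> real.
        (\<forall>M k K. 0 \<le> K \<and> K \<le> M \<and> 0 \<le> k \<and> kbar M \<le> k \<longrightarrow> f k K \<le> 0) \<and>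
        kbar \<in> o[at_top](\<lambda>M. M)) \<and>
     (\<exists>k1>0. \<forall>K\<in>I. \<forall>k. 0 < k \<and> k < k1 \<longrightarrow> 0 < f k K) \<and>
     (\<forall>K\<in>I. strictly_concave_on {0..} (\<lambda>k. f k K))"

text \<open>
  \<open>U\<close> is not assumed to be differentiable.  Being concave, it has a right derivative at every
  point of \<open>(0,\<infinity>)\<close>, and \<open>U'(0) = \<infinity>\<close>, \<open>U'(\<infinity>) = 0\<close> are read as the limits of the right
  derivative at \<open>0+\<close> and at \<open>\<infinity>\<close>.  (Infinite difference quotients at \<open>0\<close> would also be produced
  by a mere jump of \<open>U\<close> at \<open>0\<close>, which is not what is meant.)
\<close>

definition right_deriv :: "(real \<Rightarrow> real) \<Rightarrow> real \<Rightarrow> real" where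
  "right_deriv U x = vector_derivative U (at_right x)"

definition utility :: "(real \<Rightarrow> real) \<Rightarrow> bool" where
  "utility U \<longleftrightarrow>
     (\<forall>x\<ge>0. 0 \<le> U x) \<and>
     concave_on {0..} U \<and>
     strict_mono_on {0..} U \<and>
     filterlim (right_deriv U) at_top (at_right 0) \<and>
     (right_deriv U \<longlongrightarrow> 0) at_top"


section \<open>Measures on the half-line and functions of locally bounded variation\<close>

text \<open>
  Nonnegative Radon measures on \<open>[0,\<infinity>)\<close> are Borel measures on the line that give no mass to
  \<open>(-\<infinity>,0)\<close> and are finite on compact sets.  An atom at \<open>0\<close> is allowed.
\<close>

definition radon_halfline :: "real measure \<Rightarrow> bool" where
  "radon_halfline \<mu> \<longleftrightarrow>
     sets \<mu> = sets borel \<and> emeasure \<mu> {..<0} = 0 \<and> (\<forall>T. emeasure \<mu> {0..T} < \<infinity>)"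

text \<open>
  \<open>P - N\<close>, a difference of two nonnegative Radon measures on \<open>[0,\<infinity>)\<close>, is the distributional
  derivative \<open>k'\<close> on \<open>[0,\<infinity>)\<close>.  As \<open>k'\<close> is a measure on the closed half-line, the test functions
  need not vanish at \<open>0\<close>, whence the boundary term: \<open>k'({0}) = k(0+) - k(0)\<close> is the initial jump,
  i.e. \<open>k\<close> is thought of as extended by the constant \<open>k(0)\<close> to \<open>(-\<infinity>,0)\<close>.  On \<open>(0,\<infinity>)\<close> this is
  the usual distributional derivative, and whether such \<open>P\<close>, \<open>N\<close> exist does not depend on the
  value \<open>k(0)\<close>.  Since \<open>k'\<close> is a measure, testing with compactly supported \<open>C\<^sup>1\<close> functions or with
  compactly supported smooth functions is the same.
\<close>

definition has_deriv_measure :: "(real \<Rightarrow> real) \<Rightarrow> real measure \<Rightarrow> real measure \<Rightarrow> bool" where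
  "has_deriv_measure k P N \<longleftrightarrow>
     radon_halfline P \<and> radon_halfline N \<and>
     (\<forall>\<phi> :: real \<Rightarrow> real. \<phi> C1_differentiable_on UNIV \<and> bounded {t. \<phi> t \<noteq> 0} \<longrightarrow>
        (LINT t|P. \<phi> t) - (LINT t|N. \<phi> t) =
          - (\<phi> 0 * k 0) - (LINT t:{0..}|lebesgue. k t * deriv \<phi> t))"

definition BV_loc :: "(real \<Rightarrow> real) \<Rightarrow> bool" where
  "BV_loc k \<longleftrightarrow>
     (\<forall>T. k absolutely_integrable_on {0..T}) \<and> (\<exists>P N. has_deriv_measure k P N)"


section \<open>The optimisation problem\<close>

text \<open>
  The inequality \<open>k' + c \<le> f(k,K)\<close> between locally finite signed measures on \<open>[0,\<infinity>)\<close> is tested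
  on bounded Borel sets, on which all the measures are finite.
\<close>

definition admissible ::
    "(real \<Rightarrow> real \<Rightarrow> real) \<Rightarrow> (real \<Rightarrow> real) \<Rightarrow> real \<Rightarrow> ((real \<Rightarrow> real) \<times> real measure) set" where
  "admissible f K k0 = {(k, c).
     BV_loc k \<and> radon_halfline c \<and>
     (AE t in lebesgue. 0 \<le> t \<longrightarrow> 0 \<le> k t) \<and> k 0 = k0 \<and>
     (\<exists>P N. has_deriv_measure k P N \<and>
        (\<forall>A\<in>sets borel. A \<subseteq> {0..} \<and> bounded A \<longrightarrow>
           measure P A - measure N A + measure c A \<le> (LINT t:A|lebesgue. f (k t) (K t))))}"

text \<open>
  Lebesgue decomposition: \<open>g\<close> is a density of the absolutely continuous part of \<open>c\<close>, and the
  singular part of \<open>c\<close> is its restriction to the Lebesgue null set \<open>Z\<close>.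
\<close>

definition is_ac_density :: "real measure \<Rightarrow> (real \<Rightarrow> real) \<Rightarrow> bool" where
  "is_ac_density c g \<longleftrightarrow>
     g \<in> borel_measurable borel \<and> (\<forall>t. 0 \<le> g t) \<and>
     (\<exists>Z\<in>null_sets lborel. \<forall>A\<in>sets borel.
        emeasure c A = (\<integral>\<^sup>+t\<in>A. ennreal (g t) \<partial>lborel) + emeasure c (A \<inter> Z))"

definition ac_density :: "real measure \<Rightarrow> real \<Rightarrow> real" where
  "ac_density c = (SOME g. is_ac_density c g)"

definition J_inf :: "(real \<Rightarrow> real) \<Rightarrow> real \<Rightarrow> real measure \<Rightarrow> ennreal" where
  "J_inf U r c = (\<integral>\<^sup>+t\<in>{0..}. ennreal (exp (- r * t) * U (ac_density c t)) \<partial>lborel)"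

definition optimal_pair ::
    "(real \<Rightarrow> real \<Rightarrow> real) \<Rightarrow> (real \<Rightarrow> real) \<Rightarrow> real \<Rightarrow> (real \<Rightarrow> real) \<Rightarrow> real \<Rightarrow>
     (real \<Rightarrow> real) \<Rightarrow> real measure \<Rightarrow> bool" where
  "optimal_pair f U r K k0 k c \<longleftrightarrow>
     (k, c) \<in> admissible f K k0 \<and>
     (\<forall>(k', c') \<in> admissible f K k0. J_inf U r c' \<le> J_inf U r c)"

definition L1_loc :: "(real \<Rightarrow> real) \<Rightarrow> bool" where
  "L1_loc c \<longleftrightarrow> c \<in> borel_measurable borel \<and> (\<forall>T. set_integrable lborel {0..T} c)"

text \<open>The measure on \<open>[0,\<infinity>)\<close> with density \<open>c\<close>, for \<open>c \<ge> 0\<close>.\<close>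

definition measure_of_density :: "(real \<Rightarrow> real) \<Rightarrow> real measure" where
  "measure_of_density c = density lborel (\<lambda>t. ennreal (indicator {0..} t * c t))"

end

theory Submission
  imports Defs
begin

text \<open>
  The optimal pair is compared with explicit deviations.  No differential equation has to be solved for
  them: a competing capital path is written down, and only the inequality \<open>k' + c \<le> f(k,K)\<close> is checked.
  Write \<open>D\<close> for the right derivative of \<open>U\<close>.

  Deferral.  Since \<open>f\<^sub>k \<ge> -\<delta>\<close>, capital that is set aside at time \<open>s\<close> and added to the stock shrinks at the
  rate \<open>\<delta>\<close> at most, and can be consumed later (\<open>deferral_admissible\<close>).  Hence nothing is wasted at the
  optimum (\<open>no_waste\<close>), so that \<open>k' = f(k,K) - c\<close> there.  Moreover saving at the times when \<open>c \<ge> \<alpha>\<close> in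
  order to consume at later times, before \<open>S\<close>, when \<open>c \<le> \<beta>\<close> is not profitable only if
  \<open>e\<^bsup>-(r+\<delta>)S\<^esup> D(2\<beta>) \<le> D(\<alpha>/2)\<close> (\<open>deferral_inequality\<close>).  The factors \<open>2\<close> and \<open>1/2\<close> leave room for a
  finite perturbation, so that no limit is taken.  As \<open>D\<close> tends to \<open>0\<close> at infinity and to infinity at
  \<open>0\<close>, large consumption forces large consumption later, and small consumption forces small
  consumption before, uniformly on bounded horizons.

  Upper bound.  Total consumption over \<open>[T,T+1]\<close> is at most \<open>k0 + F (T+1)\<close>, where \<open>F\<close> bounds the output, so
  consumption is not large on all of this interval, hence not large before (\<open>consumption_less\<close>).

  Capital stays away from \<open>0\<close>.  If \<open>k(t)\<close> is tiny, there is little to consume right after \<open>t\<close>, because output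
  is small near zero capital.  By deferral consumption was small on all of \<open>[0,t]\<close>, and since output is
  nonnegative at low capital, the capital could not have become tiny (\<open>capital_bounded_below\<close>).

  Lower bound.  For nondecreasing \<open>\<theta>\<close> the pair \<open>((1-\<theta>) k, (1-\<theta>) c + \<theta>' k)\<close> is feasible, by concavity of \<open>f\<close> in
  \<open>k\<close> and \<open>f(0,K) = 0\<close>.  Letting \<open>\<theta>\<close> grow only while \<open>c \<le> \<beta>\<close> costs a small fraction of the finite total value
  and gains a multiple of \<open>D(2\<beta>) k\<close>.  With \<open>k \<ge> \<kappa>\<close> this bounds \<open>D(2\<beta>)\<close>, and since \<open>D\<close> is infinite at \<open>0\<close>, it keeps
  \<open>c\<close> away from \<open>0\<close> (\<open>consumption_bounded_below\<close>).

  All thresholds are chosen from \<open>f\<close>, \<open>U\<close>, \<open>I\<close>, \<open>r\<close>, \<open>k0\<close>, \<open>M\<close> and \<open>T\<close>, before \<open>K\<close> is.  The bridge between the measure inequality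
  and ordinary calculus is \<open>has_deriv_measure_iff\<close>: \<open>k' = P - N\<close> in the sense of distributions if and only if
  \<open>k(t) = k(0) + P[0,t] - N[0,t]\<close> for almost every \<open>t \<ge> 0\<close>.
\<close>

section \<open>Indefinite integrals of locally integrable functions\<close>

lemma integrable_tensor_product:
  fixes u v :: "_ \<Rightarrow> real"
  assumes "pair_sigma_finite M N" "integrable M u" "integrable N v"
  shows "integrable (M \<Otimes>\<^sub>M N) (\<lambda>(x, y). u x * v y)"
proof -
  interpret pair_sigma_finite M N by fact
  have [measurable]: "u \<in> borel_measurable M" "v \<in> borel_measurable N"
    using assms by auto
  show ?thesis
  proof (rule Fubini_integrable)
    show "integrable M (\<lambda>x. LINT y|N. norm (case (x, y) of (x, y) \<Rightarrow> u x * v y))"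
      using assms by (simp add: abs_mult)
    show "AE x in M. integrable N (\<lambda>y. case (x, y) of (x, y) \<Rightarrow> u x * v y)"
      using assms by simp
  qed measurable
qed

text \<open>
  Fubini on the triangle \<open>x \<le> y\<close>.  For \<open>M = N = lborel\<close> it is integration by parts for indefinite
  integrals; for a Radon measure \<open>M\<close> it moves the derivative of a test function onto the distribution
  function of \<open>M\<close>.
\<close>

lemma Fubini_triangle:
  fixes u v :: "real \<Rightarrow> real"
  assumes "pair_sigma_finite M N" "integrable M u" "integrable N v"
    and [measurable_cong]: "sets M = sets borel" "sets N = sets borel"
  shows "(LINT x|M. u x * (LINT y:{x..}|N. v y)) = (LINT y|N. v y * (LINT x:{..y}|M. u x))"
    and "integrable M (\<lambda>x. u x * (LINT y:{x..}|N. v y))"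
    and "integrable N (\<lambda>y. v y * (LINT x:{..y}|M. u x))"
proof -
  interpret pair_sigma_finite M N by fact
  let ?F = "\<lambda>x y. (if x \<le> y then u x * v y else 0)"
  have [measurable]: "u \<in> borel_measurable borel" "v \<in> borel_measurable borel"
    using assms(2,3) by (auto dest!: borel_measurable_integrable cong: measurable_cong_sets)
  have int: "integrable (M \<Otimes>\<^sub>M N) (case_prod ?F)"
    by (rule Bochner_Integration.integrable_bound[OF integrable_tensor_product[OF assms(1-3)]])
       auto
  have 1: "(LINT y|N. ?F x y) = u x * (LINT y:{x..}|N. v y)" for x
  proof -
    have "(LINT y|N. ?F x y) = (LINT y|N. u x * (indicator {x..} y * v y))"
      by (intro Bochner_Integration.integral_cong) (auto simp: indicator_def)
    then show ?thesis by (simp add: set_lebesgue_integral_def)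
  qed
  have 2: "(LINT x|M. ?F x y) = v y * (LINT x:{..y}|M. u x)" for y
  proof -
    have "(LINT x|M. ?F x y) = (LINT x|M. v y * (indicator {..y} x * u x))"
      by (intro Bochner_Integration.integral_cong) (auto simp: indicator_def)
    then show ?thesis by (simp add: set_lebesgue_integral_def)
  qed
  show "(LINT x|M. u x * (LINT y:{x..}|N. v y)) = (LINT y|N. v y * (LINT x:{..y}|M. u x))"
    using Fubini_integral[OF int] unfolding 1 2 by simp
  show "integrable M (\<lambda>x. u x * (LINT y:{x..}|N. v y))"
    using integrable_fst[OF int] unfolding 1 .
  show "integrable N (\<lambda>y. v y * (LINT x:{..y}|M. u x))"
    using integrable_snd[OF int] unfolding 2 .
qed

definition primitive :: "(real \<Rightarrow> real) \<Rightarrow> real \<Rightarrow> real" where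
  "primitive g t = (LBINT s:{0..t}. g s)"

lemma L1_loc_set_integrable:
  assumes "L1_loc g" "A \<in> sets borel" "A \<subseteq> {0..T}"
  shows "set_integrable lborel A g"
  using assms set_integrable_subset[of lborel "{0..T}" g A] by (simp add: L1_loc_def)

lemma L1_loc_dominated:
  assumes "L1_loc g" "h \<in> borel_measurable borel" "AE t in lborel. 0 \<le> t \<longrightarrow> \<bar>h t\<bar> \<le> \<bar>g t\<bar>"
  shows "L1_loc h"
  unfolding L1_loc_def
proof (intro conjI allI)
  fix T
  have [measurable]: "h \<in> borel_measurable borel" by fact
  have "integrable lborel (\<lambda>x. indicat_real {0..T} x *\<^sub>R g x)"
    using assms(1) by (simp add: L1_loc_def set_integrable_def)
  then show "set_integrable lborel {0..T} h"
    unfolding set_integrable_def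
    by (rule Bochner_Integration.integrable_bound)
       (use assms(3) in \<open>auto simp: indicator_def\<close>)
qed fact

lemma L1_loc_add: "L1_loc g \<Longrightarrow> L1_loc h \<Longrightarrow> L1_loc (\<lambda>t. g t + h t)"
  by (auto simp: L1_loc_def)

lemma L1_loc_diff: "L1_loc g \<Longrightarrow> L1_loc h \<Longrightarrow> L1_loc (\<lambda>t. g t - h t)"
  by (auto simp: L1_loc_def)

lemma L1_loc_cmult: "L1_loc g \<Longrightarrow> L1_loc (\<lambda>t. a * g t)"
  by (auto simp: L1_loc_def)

lemma L1_loc_locally_bounded:
  assumes "h \<in> borel_measurable borel" "\<And>T. \<exists>B. \<forall>t\<in>{0..T}. \<bar>h t\<bar> \<le> B"
  shows "L1_loc h"
  unfolding L1_loc_def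
proof (intro conjI allI)
  fix T
  have [measurable]: "h \<in> borel_measurable borel" by fact
  obtain B where B: "\<And>t. t \<in> {0..T} \<Longrightarrow> \<bar>h t\<bar> \<le> B" using assms(2) by meson
  have "integrable lborel (\<lambda>x. indicat_real {0..T} x *\<^sub>R B)"
    by (intro integrable_scaleR_left integrable_real_indicator) (auto simp: emeasure_lborel_Icc_eq)
  then show "set_integrable lborel {0..T} h"
    unfolding set_integrable_def
    by (rule Bochner_Integration.integrable_bound)
       (use B in \<open>auto simp: indicator_def intro!: order_trans[OF _ abs_ge_self]\<close>)
qed fact

lemma L1_loc_const: "L1_loc (\<lambda>t. a)"
  by (rule L1_loc_locally_bounded) auto

lemma L1_loc_mult_bounded:
  assumes "L1_loc g" "h \<in> borel_measurable borel" "\<And>T. \<exists>B. \<forall>t\<in>{0..T}. \<bar>h t\<bar> \<le> B"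
  shows "L1_loc (\<lambda>t. h t * g t)"
  unfolding L1_loc_def
proof (intro conjI allI)
  fix T
  have [measurable]: "h \<in> borel_measurable borel" "g \<in> borel_measurable borel"
    using assms(1,2) by (auto simp: L1_loc_def)
  show "(\<lambda>t. h t * g t) \<in> borel_measurable borel" by measurable
  obtain B where B: "\<And>t. t \<in> {0..T} \<Longrightarrow> \<bar>h t\<bar> \<le> B" using assms(3) by meson
  have "integrable lborel (\<lambda>x. B * (indicat_real {0..T} x *\<^sub>R g x))"
    using assms(1) by (intro integrable_mult_right) (simp add: L1_loc_def set_integrable_def)
  then show "set_integrable lborel {0..T} (\<lambda>t. h t * g t)"
    unfolding set_integrable_def
    by (rule Bochner_Integration.integrable_bound)
       (use B in \<open>auto simp: indicator_def abs_mult
          intro!: AE_I2 mult_right_mono intro: order_trans[OF _ abs_ge_self]\<close>)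
qed

lemma continuous_bounded_Icc:
  fixes h :: "real \<Rightarrow> real"
  assumes "continuous_on {0..} h"
  shows "\<exists>B. \<forall>t\<in>{0..T}. \<bar>h t\<bar> \<le> B"
proof -
  have "compact (h ` {0..T})"
    by (intro compact_continuous_image continuous_on_subset[OF assms]) auto
  then show ?thesis
    by (auto dest!: compact_imp_bounded simp: bounded_iff)
qed

lemma L1_loc_continuous:
  assumes "continuous_on UNIV h"
  shows "L1_loc h"
  using assms by (intro L1_loc_locally_bounded continuous_bounded_Icc borel_measurable_continuous_onI)
    (auto intro: continuous_on_subset)

lemma L1_loc_mult_continuous:
  assumes "L1_loc g" "continuous_on UNIV h"
  shows "L1_loc (\<lambda>t. h t * g t)"
  using assms(2) by (intro L1_loc_mult_bounded[OF assms(1)] continuous_bounded_Icc borel_measurable_continuous_onI)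
    (auto intro: continuous_on_subset)

lemma L1_loc_absolutely_integrable: "L1_loc g \<Longrightarrow> g absolutely_integrable_on {0..T}"
  unfolding L1_loc_def set_integrable_def by (subst integrable_completion) auto

lemma primitive_eq_integral:
  assumes "L1_loc g"
  shows "primitive g T = integral {0..T} g" "g integrable_on {0..T}"
  using assms set_borel_integral_eq_integral[of "{0..T}" g]
  by (auto simp: L1_loc_def primitive_def)

lemma primitive_0 [simp]: "L1_loc g \<Longrightarrow> primitive g 0 = 0"
  by (simp add: primitive_eq_integral)

lemma continuous_on_primitive:
  assumes "L1_loc g"
  shows "continuous_on {0..} (primitive g)"
proof -
  have "continuous_on {0..T} (primitive g)" for T
    using indefinite_integral_continuous_1[OF primitive_eq_integral(2)[OF assms], of T]
    by (simp add: primitive_eq_integral(1)[OF assms])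
  note * = this
  show ?thesis
    unfolding continuous_on_eq_continuous_within
  proof
    fix x :: real assume "x \<in> {0..}"
    have "continuous (at x within {0..x+1}) (primitive g)"
      using *[of "x+1"] \<open>x \<in> {0..}\<close>
      by (simp add: continuous_on_eq_continuous_within)
    moreover have "at x within {0..x+1} = at x within {0..}"
      by (rule at_within_nhd[of _ "{..<x+1}"]) auto
    ultimately show "continuous (at x within {0..}) (primitive g)"
      by simp
  qed
qed

lemma primitive_neg: "t < 0 \<Longrightarrow> primitive g t = 0"
  by (simp add: primitive_def set_lebesgue_integral_def)

lemma borel_measurable_primitive [measurable]:
  assumes "L1_loc g"
  shows "primitive g \<in> borel_measurable borel"
proof -
  have "(\<lambda>t. if t \<in> {0..} then primitive g t else 0) \<in> borel_measurable borel"
    by (intro borel_measurable_continuous_on_if continuous_on_primitive assms) auto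
  also have "(\<lambda>t. if t \<in> {0..} then primitive g t else 0) = primitive g"
    by (auto simp: primitive_neg)
  finally show ?thesis .
qed

lemma primitive_bounded:
  assumes "L1_loc g"
  shows "\<exists>B. \<forall>t\<in>{0..T}. \<bar>primitive g t\<bar> \<le> B"
  by (rule continuous_bounded_Icc[OF continuous_on_primitive[OF assms]])

lemma L1_loc_primitive: "L1_loc g \<Longrightarrow> L1_loc (primitive g)"
  by (rule L1_loc_locally_bounded[OF borel_measurable_primitive primitive_bounded])

lemma L1_loc_mult_primitive:
  assumes "L1_loc q" "L1_loc r"
  shows "L1_loc (\<lambda>t. primitive q t * r t)"
  using assms by (intro L1_loc_mult_bounded primitive_bounded) auto

lemma primitive_diff_eq:
  assumes "L1_loc g" "0 \<le> a" "a \<le> b"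
  shows "primitive g b - primitive g a = (LBINT s:{a..b}. g s)"
proof -
  have "(LBINT s:{a..b}. g s) = integral {a..b} g"
    using L1_loc_set_integrable[OF assms(1), of "{a..b}" b] assms
    by (intro set_borel_integral_eq_integral) auto
  then show ?thesis
    using Henstock_Kurzweil_Integration.integral_combine[OF assms(2,3) primitive_eq_integral(2)[OF assms(1)]]
    by (simp add: primitive_eq_integral(1)[OF assms(1)])
qed

lemma primitive_add:
  assumes "L1_loc g" "L1_loc h"
  shows "primitive (\<lambda>t. g t + h t) T = primitive g T + primitive h T"
  unfolding primitive_def using assms by (intro set_integral_add) (auto simp: L1_loc_def)

lemma primitive_diff:
  assumes "L1_loc g" "L1_loc h"
  shows "primitive (\<lambda>t. g t - h t) T = primitive g T - primitive h T"
  unfolding primitive_def using assms by (intro set_integral_diff) (auto simp: L1_loc_def)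

lemma primitive_cmult: "primitive (\<lambda>t. a * g t) T = a * primitive g T"
  unfolding primitive_def by simp

lemma primitive_const: "0 \<le> T \<Longrightarrow> primitive (\<lambda>t. a) T = a * T"
  unfolding primitive_def set_lebesgue_integral_def by simp

lemma primitive_cong: "(\<And>s. 0 \<le> s \<Longrightarrow> s \<le> t \<Longrightarrow> g s = h s) \<Longrightarrow> primitive g t = primitive h t"
  unfolding primitive_def set_lebesgue_integral_def
  by (intro Bochner_Integration.integral_cong) (auto simp: indicator_def)

lemma primitive_mono_AE:
  assumes "L1_loc g" "L1_loc h"
    and "AE t in lborel. 0 \<le> t \<and> t \<le> T \<longrightarrow> g t \<le> h t"
  shows "primitive g T \<le> primitive h T"
proof -
  show ?thesis
    unfolding primitive_def set_lebesgue_integral_def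
    using assms by (intro integral_mono_AE) (auto simp: indicator_def L1_loc_def set_integrable_def)
qed

lemma primitive_nonneg:
  assumes "AE t in lborel. 0 \<le> t \<and> t \<le> T \<longrightarrow> 0 \<le> g t"
  shows "0 \<le> primitive g T"
  unfolding primitive_def set_lebesgue_integral_def
  using assms by (intro integral_nonneg_AE) (auto simp: indicator_def)

lemma primitive_increment_le:
  assumes g: "L1_loc g" and ab: "0 \<le> a" "a \<le> b"
    and le: "AE s in lborel. a < s \<and> s \<le> b \<longrightarrow> g s \<le> C"
  shows "primitive g b - primitive g a \<le> C * (b - a)"
proof -
  have "(LBINT s:{a..b}. g s) \<le> (LBINT s:{a..b}. C)"
    unfolding set_lebesgue_integral_def
  proof (rule integral_mono_AE)
    show "integrable lborel (\<lambda>s. indicat_real {a..b} s *\<^sub>R g s)" "integrable lborel (\<lambda>s. indicat_real {a..b} s *\<^sub>R C)"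
      using L1_loc_set_integrable[OF g, of "{a..b}" b] L1_loc_set_integrable[OF L1_loc_const[of C], of "{a..b}" b] ab
      by (auto simp: set_integrable_def)
    show "AE s in lborel. indicat_real {a..b} s *\<^sub>R g s \<le> indicat_real {a..b} s *\<^sub>R C"
      using le AE_lborel_singleton[of a] by eventually_elim (auto simp: indicator_def)
  qed
  then show ?thesis
    using primitive_diff_eq[OF g ab] ab by (simp add: set_lebesgue_integral_def mult.commute)
qed

lemma primitive_increment_ge:
  assumes g: "L1_loc g" and ab: "0 \<le> a" "a \<le> b"
    and ge: "AE s in lborel. a < s \<and> s \<le> b \<longrightarrow> C \<le> g s"
  shows "C * (b - a) \<le> primitive g b - primitive g a"
proof -
  have "primitive (\<lambda>s. - 1 * g s) b - primitive (\<lambda>s. - 1 * g s) a \<le> - C * (b - a)"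
    using ge by (intro primitive_increment_le L1_loc_cmult g ab) (auto elim: eventually_mono)
  then show ?thesis unfolding primitive_cmult by simp
qed

text \<open>
  The square \<open>[0,t] \<times> [0,t]\<close> is cut along the diagonal, and the two triangles are integrated in
  opposite orders.
\<close>

lemma primitive_mult:
  assumes q: "L1_loc q" and r: "L1_loc r" and t: "0 \<le> t"
  shows "primitive q t * primitive r t =
           primitive (\<lambda>s. primitive q s * r s + primitive r s * q s) t"
proof -
  have [measurable]: "q \<in> borel_measurable borel" "r \<in> borel_measurable borel"
    using q r by (auto simp: L1_loc_def)
  let ?u = "\<lambda>s. indicator {0..t} s * q s" and ?v = "\<lambda>s. indicator {0..t} s * r s"
  have iu: "integrable lborel ?u" and iv: "integrable lborel ?v"
    using q r by (auto simp: L1_loc_def set_integrable_def)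
  have 1: "?u x * (LINT y:{x..}|lborel. ?v y) = ?u x * (primitive r t - primitive r x)" for x
  proof (cases "x \<in> {0..t}")
    case True
    then have "(LINT y:{x..}|lborel. ?v y) = (LBINT s:{x..t}. r s)"
      unfolding set_lebesgue_integral_def
      by (intro Bochner_Integration.integral_cong) (auto simp: indicator_def)
    with True show ?thesis using primitive_diff_eq[OF r, of x t] by simp
  qed auto
  have 2: "?v y * (LINT x:{..y}|lborel. ?u x) = ?v y * primitive q y" for y
  proof (cases "y \<in> {0..t}")
    case True
    then have "(LINT x:{..y}|lborel. ?u x) = primitive q y"
      unfolding set_lebesgue_integral_def primitive_def
      by (intro Bochner_Integration.integral_cong) (auto simp: indicator_def)
    then show ?thesis by simp
  qed auto
  have "(LBINT x. ?u x * (primitive r t - primitive r x)) = (LBINT y. ?v y * primitive q y)"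
    using Fubini_triangle(1)[OF lborel_pair.pair_sigma_finite_axioms iu iv] unfolding 1 2 by simp
  also have "(LBINT y. ?v y * primitive q y) = primitive (\<lambda>s. primitive q s * r s) t"
    unfolding primitive_def[of _ t] set_lebesgue_integral_def
    by (intro Bochner_Integration.integral_cong) (auto simp: mult_ac)
  also have "(LBINT x. ?u x * (primitive r t - primitive r x)) =
      primitive (\<lambda>s. primitive r t * q s - primitive r s * q s) t"
    unfolding primitive_def[of _ t] set_lebesgue_integral_def
    by (intro Bochner_Integration.integral_cong) (auto simp: algebra_simps)
  also have "\<dots> = primitive r t * primitive q t - primitive (\<lambda>s. primitive r s * q s) t"
    using q r by (subst primitive_diff) (auto intro!: L1_loc_cmult L1_loc_mult_primitive simp: primitive_cmult)
  finally show ?thesis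
    using primitive_add[OF L1_loc_mult_primitive[OF q r] L1_loc_mult_primitive[OF r q], of t]
    by (simp add: mult.commute)
qed

text \<open>
  Leibniz rule for functions that are absolutely continuous in the sense of being indefinite
  integrals.  Competing capital paths are built from such functions by sums and
  products, and this rule yields their derivatives.
\<close>

lemma primitive_product_rule:
  assumes q: "L1_loc q" and r: "L1_loc r" and t: "0 \<le> t"
  shows "(a + primitive q t) * (b + primitive r t) =
           a * b + primitive (\<lambda>s. (a + primitive q s) * r s + (b + primitive r s) * q s) t"
proof -
  have "primitive (\<lambda>s. (a + primitive q s) * r s + (b + primitive r s) * q s) t =
    primitive (\<lambda>s. (a * r s + b * q s) + (primitive q s * r s + primitive r s * q s)) t"
    by (simp add: algebra_simps)
  also have "\<dots> = a * primitive r t + b * primitive q t + primitive q t * primitive r t"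
    unfolding primitive_mult[OF assms]
    using q r by (subst primitive_add primitive_cmult |
      auto intro!: L1_loc_cmult L1_loc_mult_primitive L1_loc_add)+
  finally show ?thesis by (simp add: algebra_simps)
qed

lemma primitive_deriv:
  assumes "\<And>s. (F has_real_derivative g s) (at s)" "continuous_on UNIV g" "0 \<le> t"
  shows "F t = F 0 + primitive g t" and "L1_loc g"
proof -
  show L: "L1_loc g" by (rule L1_loc_continuous[OF assms(2)])
  have "(g has_integral (F t - F 0)) {0..t}"
    using assms(1,3) by (intro fundamental_theorem_of_calculus)
      (auto simp: has_real_derivative_iff_has_vector_derivative intro: has_vector_derivative_at_within)
  then show "F t = F 0 + primitive g t"
    by (simp add: primitive_eq_integral[OF L] integral_unique)
qed

lemma primitive_exp:
  assumes "0 \<le> t"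
  shows "exp (a * t) = 1 + primitive (\<lambda>s. a * exp (a * s)) t" "L1_loc (\<lambda>s. a * exp (a * s))"
    "L1_loc (\<lambda>s. exp (a * s))"
proof -
  have d: "((\<lambda>s. exp (a * s)) has_real_derivative a * exp (a * s)) (at s)" for s
    by (auto intro!: derivative_eq_intros)
  have c: "continuous_on UNIV (\<lambda>s. a * exp (a * s))" by (intro continuous_intros)
  show "exp (a * t) = 1 + primitive (\<lambda>s. a * exp (a * s)) t" "L1_loc (\<lambda>s. a * exp (a * s))"
    using primitive_deriv[OF d c assms] by auto
  show "L1_loc (\<lambda>s. exp (a * s))" by (intro L1_loc_continuous continuous_intros)
qed

lemma AE_notin_of_measure_zero:
  assumes "B \<in> sets borel" "B \<subseteq> {a..b::real}" "\<not> 0 < measure lborel B"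
  shows "AE t in lborel. t \<notin> B"
proof (rule AE_not_in)
  have "emeasure lborel B \<le> emeasure lborel {a..b}" using assms by (intro emeasure_mono) auto
  also have "\<dots> < \<infinity>" by (simp add: emeasure_lborel_Icc_eq)
  finally show "B \<in> null_sets lborel"
    using assms by (intro null_setsI) (auto simp: emeasure_eq_ennreal_measure zero_less_measure_iff)
qed

lemma integrable_indicator_subset_Icc:
  assumes "B \<in> sets borel" "B \<subseteq> {a..b::real}"
  shows "integrable lborel (indicat_real B)"
proof (rule integrable_real_indicator)
  have "emeasure lborel B \<le> emeasure lborel {a..b}" using assms by (intro emeasure_mono) auto
  also have "\<dots> < \<infinity>" by (simp add: emeasure_lborel_Icc_eq)
  finally show "emeasure lborel B < \<infinity>" .
qed (use assms in auto)

lemma primitive_indicator: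
  assumes "B \<in> sets borel"
  shows "primitive (indicat_real B) t = measure lborel (B \<inter> {0..t})" "L1_loc (indicat_real B)"
proof -
  have "primitive (indicat_real B) t = (LBINT s. indicat_real (B \<inter> {0..t}) s)"
    unfolding primitive_def set_lebesgue_integral_def
    by (intro Bochner_Integration.integral_cong) (auto simp: indicator_def)
  then show "primitive (indicat_real B) t = measure lborel (B \<inter> {0..t})" by simp
  show "L1_loc (indicat_real B)"
    using assms by (intro L1_loc_locally_bounded) (auto intro!: exI[of _ 1] simp: indicator_def)
qed

text \<open>
  Otherwise \<open>c > \<beta>\<close> almost everywhere on \<open>(a,b]\<close>, and the mean would be at least \<open>\<beta>\<close>.
\<close>

lemma small_values_on_interval:
  assumes c: "L1_loc c" and ab: "0 \<le> a" "a < b"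
    and le: "primitive c b - primitive c a \<le> \<eta> * (b - a)" and "\<eta> < \<beta>"
  shows "0 < measure lborel {t \<in> {a<..b}. c t \<le> \<beta>}"
proof (rule ccontr)
  have [measurable]: "c \<in> borel_measurable borel" using c by (simp add: L1_loc_def)
  let ?B = "{t \<in> {a<..b}. c t \<le> \<beta>}"
  assume "\<not> 0 < measure lborel ?B"
  then have "measure lborel ?B = 0" by (simp add: zero_less_measure_iff)
  moreover have "emeasure lborel ?B \<le> emeasure lborel {a<..b}" by (intro emeasure_mono) auto
  then have "emeasure lborel ?B < \<infinity>" using ab by (auto simp: top.not_eq_extremum intro: le_less_trans)
  ultimately have "?B \<in> null_sets lborel"
    by (intro null_setsI) (auto simp: emeasure_eq_ennreal_measure)
  then have "AE t in lborel. t \<notin> ?B" by (rule AE_not_in)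
  then have "\<beta> * (b - a) \<le> primitive c b - primitive c a"
    using ab by (intro primitive_increment_ge[OF c]) (auto elim: eventually_mono)
  also note le
  finally show False using ab \<open>\<eta> < \<beta>\<close> by simp
qed

lemma AE_halfline_dense:
  assumes "AE t in lborel. 0 \<le> t \<longrightarrow> P t" "0 \<le> a" "a < (b::real)"
  obtains t where "a < t" "t < b" "P t"
proof -
  have "\<not> (AE t in lborel. t \<notin> {a<..<b})"
  proof
    assume "AE t in lborel. t \<notin> {a<..<b}"
    then have "{a<..<b} \<in> null_sets lborel" by (subst AE_iff_null_sets) auto
    with \<open>a < b\<close> show False by (simp add: null_sets_def)
  qed
  moreover have "AE t in lborel. t \<notin> {a<..<b}" if "\<And>t. a < t \<Longrightarrow> t < b \<Longrightarrow> \<not> P t"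
    using assms(1) by eventually_elim (use that assms(2) in auto)
  ultimately show thesis using that by blast
qed

lemma continuous_AE_nonneg:
  assumes "continuous_on {0..} g" "AE t in lborel. 0 \<le> t \<longrightarrow> 0 \<le> g t" "0 \<le> (t::real)"
  shows "0 \<le> (g t :: real)"
proof (rule ccontr)
  assume neg: "\<not> 0 \<le> g t"
  have "(g \<longlongrightarrow> g t) (at t within {0..})" using assms(1,3) by (auto simp: continuous_on_def)
  then have "(g \<longlongrightarrow> g t) (at_right t)" by (rule tendsto_within_subset) (use assms(3) in auto)
  then have "\<forall>\<^sub>F s in at_right t. g s < 0" using neg by (intro order_tendstoD) auto
  then obtain b where b: "t < b" "\<And>s. t < s \<Longrightarrow> s < b \<Longrightarrow> g s < 0"
    by (auto simp: eventually_at_right_field)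
  obtain s where "t < s" "s < b" "0 \<le> g s" using AE_halfline_dense[OF assms(2,3) b(1)] by blast
  with b(2)[of s] show False by simp
qed

text \<open>
  Capital and externality are only Lebesgue measurable, and passing to Borel versions lets all
  integrals be taken with respect to \<open>lborel\<close>.
\<close>

lemma L1_loc_representative:
  assumes "\<And>T. k absolutely_integrable_on {0..T::real}"
  obtains k' where "L1_loc k'" "AE t in lborel. 0 \<le> t \<longrightarrow> k t = k' t"
proof -
  have *: "(\<lambda>t. indicat_real {0..real n} t * k t) \<in> borel_measurable lebesgue" for n
    using assms[of "real n"] by (auto simp: set_integrable_def)
  have "(\<lambda>t. indicat_real {0..} t * k t) \<in> borel_measurable lebesgue"
  proof (rule borel_measurable_LIMSEQ_real[OF _ *])
    fix t :: real
    have "eventually (\<lambda>n. indicat_real {0..real n} t * k t = indicat_real {0..} t * k t) sequentially"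
      using eventually_ge_at_top[of "nat \<lceil>t\<rceil>"]
      by eventually_elim (auto simp: indicator_def nat_le_iff ceiling_le_iff)
    then show "(\<lambda>n. indicat_real {0..real n} t * k t) \<longlonglongrightarrow> indicat_real {0..} t * k t"
      by (rule tendsto_eventually)
  qed
  from completion_ex_borel_measurable_real[OF this] obtain k'
    where [measurable]: "k' \<in> borel_measurable lborel"
      and k': "AE t in lborel. indicat_real {0..} t * k t = k' t" by auto
  show thesis
  proof
    show "AE t in lborel. 0 \<le> t \<longrightarrow> k t = k' t"
      using k' by eventually_elim auto
    show "L1_loc k'"
      unfolding L1_loc_def
    proof (intro conjI allI)
      fix T
      have "AE t in lebesgue. indicat_real {0..T} t *\<^sub>R k t = indicat_real {0..T} t *\<^sub>R k' t"
        unfolding AE_completion_iff using k' by eventually_elim (auto simp: indicator_def)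
      then have "integrable lebesgue (\<lambda>t. indicat_real {0..T} t *\<^sub>R k' t)"
        using assms[of T] unfolding set_integrable_def
        by (subst integrable_cong_AE[symmetric]) (auto intro!: measurable_completion)
      then show "set_integrable lborel {0..T} k'"
        unfolding set_integrable_def by (subst (asm) integrable_completion) auto
    qed auto
  qed
qed

lemma set_integral_lebesgue_representative:
  assumes [measurable]: "y \<in> borel_measurable borel" "A \<in> sets borel"
    and "AE t in lborel. t \<in> A \<longrightarrow> z t = (y t :: real)"
  shows "(LINT t:A|lebesgue. z t) = (LBINT t:A. y t)"
proof -
  have ae: "AE t in lebesgue. indicat_real A t *\<^sub>R y t = indicat_real A t *\<^sub>R z t"
    unfolding AE_completion_iff using assms(3) by eventually_elim (auto simp: indicator_def)
  have m: "(\<lambda>t. indicat_real A t *\<^sub>R y t) \<in> borel_measurable lebesgue"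
    by (intro measurable_completion) measurable
  have "(LINT t:A|lebesgue. y t) = (LINT t:A|lebesgue. z t)"
    unfolding set_lebesgue_integral_def
    by (rule integral_cong_AE[OF m borel_measurable_AE[OF m ae] ae])
  moreover have "(LINT t:A|lebesgue. y t) = (LBINT t:A. y t)"
    unfolding set_lebesgue_integral_def by (intro integral_completion) measurable
  ultimately show ?thesis by simp
qed

section \<open>Distributional derivatives on the half-line\<close>

lemma measure_radon_mono:
  assumes "radon_halfline \<mu>" "s \<le> t"
  shows "measure \<mu> {0..s} \<le> measure \<mu> {0..t}"
  using assms unfolding radon_halfline_def by (intro measure_mono_fmeasurable) (auto simp: fmeasurable_def)

lemma L1_loc_measure_radon:
  assumes "radon_halfline \<mu>"
  shows "L1_loc (\<lambda>t. measure \<mu> {0..t})"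
proof (rule L1_loc_locally_bounded)
  show "(\<lambda>t. measure \<mu> {0..t}) \<in> borel_measurable borel"
    by (rule borel_measurable_mono) (auto intro: monoI measure_radon_mono assms)
  show "\<exists>B. \<forall>t\<in>{0..T}. \<bar>measure \<mu> {0..t}\<bar> \<le> B" for T
    by (rule exI[of _ "measure \<mu> {0..T}"]) (auto intro: measure_radon_mono assms)
qed

lemma sigma_finite_radon:
  assumes "radon_halfline \<mu>"
  shows "sigma_finite_measure \<mu>"
proof
  have [simp]: "space \<mu> = UNIV"
    using assms sets_eq_imp_space_eq[of \<mu> borel] by (simp add: radon_halfline_def)
  let ?A = "insert {..<0} (range (\<lambda>n. {0..real n}))"
  have "x \<in> \<Union>?A" for x :: real
    using real_arch_simple[of x] by (cases "x < 0") auto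
  then have "\<Union>?A = space \<mu>" by (simp only: \<open>space \<mu> = UNIV\<close> set_eq_iff) simp
  then show "\<exists>A. countable A \<and> A \<subseteq> sets \<mu> \<and> \<Union> A = space \<mu> \<and> (\<forall>a\<in>A. emeasure \<mu> a \<noteq> \<infinity>)"
    using assms by (intro exI[of _ ?A]) (auto simp: radon_halfline_def less_top[symmetric])
qed

lemma test_function:
  fixes \<phi> :: "real \<Rightarrow> real"
  assumes "\<phi> C1_differentiable_on UNIV" "bounded {t. \<phi> t \<noteq> 0}"
  obtains R where "0 < R" "\<And>t. R \<le> t \<Longrightarrow> \<phi> t = 0" "\<And>t. R \<le> t \<Longrightarrow> deriv \<phi> t = 0"
    "\<And>t. (\<phi> has_real_derivative deriv \<phi> t) (at t)" "continuous_on UNIV (deriv \<phi>)"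
proof -
  obtain D where D: "\<And>t. (\<phi> has_real_derivative D t) (at t)" "continuous_on UNIV D"
    using assms(1) by (auto simp: C1_differentiable_on_def has_real_derivative_iff_has_vector_derivative)
  have D_eq: "deriv \<phi> = D" using D(1) by (auto intro: DERIV_imp_deriv)
  obtain B where B: "\<And>t. \<phi> t \<noteq> 0 \<Longrightarrow> \<bar>t\<bar> \<le> B" using assms(2) by (auto simp: bounded_iff)
  have 0: "\<phi> t = 0" if "B < t" for t using B[of t] that by (cases "\<phi> t = 0") auto
  have "D t = 0" if "B < t" for t
  proof -
    have "((\<lambda>_. 0) has_real_derivative D t) (at t)"
      by (rule has_field_derivative_transform_within_open[OF D(1)[of t], of "{B<..}"]) (use 0 that in auto)
    then show ?thesis by (metis DERIV_const DERIV_unique)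
  qed
  with 0 D show thesis by (intro that[of "max B 0 + 1"]) (auto simp: D_eq)
qed

text \<open>
  As \<open>\<phi>(t)\<close> is minus the integral of \<open>\<phi>'\<close> over \<open>[t,\<infinity>)\<close>, Fubini turns the integral of \<open>\<phi>\<close> into an
  integral of \<open>\<phi>'\<close> against the distribution function of \<open>\<mu>\<close>, atom at \<open>0\<close> included.
\<close>

lemma radon_integral_test_function:
  assumes \<mu>: "radon_halfline \<mu>" and \<phi>: "\<phi> C1_differentiable_on UNIV" "bounded {t. \<phi> t \<noteq> 0}"
  shows "(LINT t|\<mu>. \<phi> t) = - (LBINT s:{0..}. measure \<mu> {0..s} * deriv \<phi> s)"
proof -
  obtain R where R: "0 < R" "\<And>t. R \<le> t \<Longrightarrow> \<phi> t = 0" "\<And>t. R \<le> t \<Longrightarrow> deriv \<phi> t = 0"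
    "\<And>t. (\<phi> has_real_derivative deriv \<phi> t) (at t)" "continuous_on UNIV (deriv \<phi>)"
    using test_function[OF \<phi>] by blast
  have [measurable_cong]: "sets \<mu> = sets borel" using \<mu> by (simp add: radon_halfline_def)
  have sp: "space \<mu> = UNIV" using sets_eq_imp_space_eq[OF \<open>sets \<mu> = sets borel\<close>] by simp
  have [measurable]: "deriv \<phi> \<in> borel_measurable borel" "\<phi> \<in> borel_measurable borel"
    using R(4,5) by (auto intro!: borel_measurable_continuous_onI continuous_at_imp_continuous_on
      dest: DERIV_isCont)
  interpret sigma_finite_measure \<mu> by (rule sigma_finite_radon[OF \<mu>])
  interpret pair_sigma_finite \<mu> lborel ..
  let ?u = "indicat_real {0..R}" and ?v = "\<lambda>s. indicator {0..R} s * deriv \<phi> s"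
  have u: "integrable \<mu> ?u"
    using \<mu> by (intro integrable_real_indicator) (auto simp: radon_halfline_def)
  have L: "L1_loc (deriv \<phi>)" using primitive_deriv(2)[OF R(4,5), of 0] by simp
  then have v: "integrable lborel ?v" by (auto simp: L1_loc_def set_integrable_def)
  have 1: "?u x * (LINT y:{x..}|lborel. ?v y) = - (?u x * \<phi> x)" for x
  proof (cases "x \<in> {0..R}")
    case True
    then have "(LINT y:{x..}|lborel. ?v y) = (LBINT s:{x..R}. deriv \<phi> s)"
      unfolding set_lebesgue_integral_def
      by (intro Bochner_Integration.integral_cong) (auto simp: indicator_def)
    also have "\<dots> = \<phi> R - \<phi> x"
      using primitive_diff_eq[OF L, of x R] True primitive_deriv(1)[OF R(4,5), of x]
        primitive_deriv(1)[OF R(4,5), of R] by simp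
    finally show ?thesis using R(2)[of R] by simp
  qed auto
  have 2: "?v y * (LINT x:{..y}|\<mu>. ?u x) = ?v y * measure \<mu> {0..y}" for y
  proof (cases "y \<in> {0..R}")
    case True
    then have "(LINT x:{..y}|\<mu>. ?u x) = (LINT x|\<mu>. indicator {0..y} x)"
      unfolding set_lebesgue_integral_def
      by (intro Bochner_Integration.integral_cong) (auto simp: indicator_def)
    then show ?thesis by (simp add: sp)
  qed auto
  have "AE x in \<mu>. x \<notin> {..<0}"
    using \<mu> by (intro AE_not_in) (auto simp: null_sets_def radon_halfline_def)
  then have "AE t in \<mu>. \<phi> t = ?u t * \<phi> t"
  proof eventually_elim
    case (elim t)
    then show ?case using R(2)[of t] by (cases "t \<le> R") auto
  qed
  then have "(LINT t|\<mu>. \<phi> t) = (LINT t|\<mu>. ?u t * \<phi> t)"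
    by (intro integral_cong_AE) auto
  also have "\<dots> = - (LBINT y. ?v y * measure \<mu> {0..y})"
    using Fubini_triangle(1)[OF pair_sigma_finite_axioms u v] unfolding 1 2
    by (simp add: \<open>sets \<mu> = sets borel\<close>)
  also have "(LBINT y. ?v y * measure \<mu> {0..y}) = (LBINT s:{0..}. measure \<mu> {0..s} * deriv \<phi> s)"
    unfolding set_lebesgue_integral_def
    by (intro Bochner_Integration.integral_cong) (auto simp: indicator_def R(3))
  finally show ?thesis .
qed

lemma L1_loc_integrable_test_function:
  assumes g: "L1_loc g" and \<phi>: "\<phi> C1_differentiable_on UNIV" "bounded {t. \<phi> t \<noteq> 0}"
  shows "set_integrable lborel {0..} (\<lambda>s. g s * deriv \<phi> s)"
proof -
  obtain R where R: "0 < R" "\<And>t. R \<le> t \<Longrightarrow> \<phi> t = 0" "\<And>t. R \<le> t \<Longrightarrow> deriv \<phi> t = 0"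
    "\<And>t. (\<phi> has_real_derivative deriv \<phi> t) (at t)" "continuous_on UNIV (deriv \<phi>)"
    using test_function[OF \<phi>] by blast
  have "L1_loc (\<lambda>s. deriv \<phi> s * g s)" by (rule L1_loc_mult_continuous[OF g R(5)])
  then have "set_integrable lborel {0..R} (\<lambda>s. deriv \<phi> s * g s)" by (auto simp: L1_loc_def)
  then show ?thesis
    unfolding set_integrable_def
    by (rule Bochner_Integration.integrable_cong[OF refl, THEN iffD1, rotated])
       (auto simp: indicator_def R(3))
qed

text \<open>
  \<open>\<tau>\<close> rises linearly from \<open>0\<close> to \<open>1\<close> over \<open>[0,\<epsilon>]\<close>, and \<open>E\<close> is its antiderivative.
\<close>

lemma smooth_ramp:
  fixes \<epsilon> :: real
  assumes "0 < \<epsilon>"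
  defines "E \<equiv> \<lambda>x. ((max 0 x)\<^sup>2 - (max 0 (x - \<epsilon>))\<^sup>2) / (2 * \<epsilon>)"
    and "\<tau> \<equiv> \<lambda>x. max 0 (min 1 (x / \<epsilon>))"
  shows "(E has_real_derivative \<tau> x) (at x)" "x \<le> 0 \<Longrightarrow> E x = 0" "\<epsilon> \<le> x \<Longrightarrow> E x = x - \<epsilon> / 2"
proof -
  have *: "((\<lambda>x. (max 0 x)\<^sup>2) has_real_derivative 2 * max 0 x) (at x)" for x :: real
  proof (cases "x = 0")
    case True
    have "((\<lambda>h. (max 0 h)\<^sup>2 / h) \<longlongrightarrow> 0) (at (0::real))"
    proof (rule Lim_null_comparison)
      show "\<forall>\<^sub>F h in at 0. norm ((max 0 h)\<^sup>2 / h) \<le> \<bar>h :: real\<bar>"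
        by (auto simp: eventually_at_filter max_def power2_eq_square)
      show "((\<lambda>h::real. \<bar>h\<bar>) \<longlongrightarrow> 0) (at 0)" by (rule tendsto_rabs_zero) simp
    qed
    with True show ?thesis by (simp add: DERIV_def)
  next
    case False
    show ?thesis
    proof (cases "0 < x")
      case True
      have "((\<lambda>x. x\<^sup>2) has_real_derivative 2 * x) (at x)" by (auto intro!: derivative_eq_intros)
      then show ?thesis
        by (rule has_field_derivative_transform_within_open[of _ _ _ "{0<..}", THEN DERIV_cong]) (use True in auto)
    next
      case neg: False
      have "((\<lambda>x. 0) has_real_derivative 0) (at x)" by simp
      then show ?thesis
        by (rule has_field_derivative_transform_within_open[of _ _ _ "{..<0}", THEN DERIV_cong]) (use neg False in auto)
    qed
  qed
  have "((\<lambda>x. (max 0 (x - \<epsilon>))\<^sup>2) has_real_derivative 2 * max 0 (x - \<epsilon>) * 1) (at x)"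
    by (rule DERIV_chain2[OF *]) (auto intro!: derivative_eq_intros)
  then have "(E has_real_derivative (2 * max 0 x - 2 * max 0 (x - \<epsilon>)) / (2 * \<epsilon>)) (at x)"
    unfolding E_def by (intro DERIV_cdivide DERIV_diff *) simp
  also have "(2 * max 0 x - 2 * max 0 (x - \<epsilon>)) / (2 * \<epsilon>) = \<tau> x"
  proof -
    consider "x \<le> 0" | "0 < x" "x < \<epsilon>" | "\<epsilon> \<le> x" by linarith
    then show ?thesis
    proof cases
      case 1
      then have "x / \<epsilon> \<le> 0" using assms(1) by (simp add: divide_nonpos_pos)
      with 1 show ?thesis using assms(1) by (simp add: \<tau>_def max_absorb1 min_absorb2)
    next
      case 2
      then have "x / \<epsilon> < 1" "0 < x / \<epsilon>" using assms(1) by auto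
      with 2 show ?thesis by (simp add: \<tau>_def max_absorb1 max_absorb2 min_absorb2)
    next
      case 3
      then have "1 \<le> x / \<epsilon>" using assms(1) by (simp add: le_divide_eq_1_pos)
      with 3 show ?thesis using assms(1) by (simp add: \<tau>_def max_absorb2 min_absorb1)
    qed
  qed
  finally show "(E has_real_derivative \<tau> x) (at x)" .
  show "x \<le> 0 \<Longrightarrow> E x = 0" using assms(1) by (auto simp: E_def max_def)
  show "\<epsilon> \<le> x \<Longrightarrow> E x = x - \<epsilon> / 2"
    using assms(1) by (auto simp: E_def max_def power2_eq_square field_simps)
qed

text \<open>
  On the half-line the derivative of this test function approximates the indicator of \<open>(a,b]\<close>.
  The antiderivative of that approximation that vanishes near \<open>-\<infinity>\<close> tends to \<open>b - a\<close> at \<open>\<infinity>\<close>, so a copy shifted to the negative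
  half-line is subtracted to make the support bounded; nothing is tested there.
\<close>

lemma ramp_difference_test_function:
  fixes a b \<epsilon> :: real
  assumes \<epsilon>: "0 < \<epsilon>" "\<epsilon> \<le> 1" and ab: "0 \<le> a" "a < b"
  obtains \<phi> where "\<phi> C1_differentiable_on UNIV" "bounded {t. \<phi> t \<noteq> 0}"
    "\<And>t. 0 \<le> t \<Longrightarrow> deriv \<phi> t = max 0 (min 1 ((t - a) / \<epsilon>)) - max 0 (min 1 ((t - b) / \<epsilon>))"
proof -
  define E where "E = (\<lambda>x. ((max 0 x)\<^sup>2 - (max 0 (x - \<epsilon>))\<^sup>2) / (2 * \<epsilon>))"
  define \<tau> where "\<tau> = (\<lambda>x. max 0 (min 1 (x / \<epsilon>)))"
  have E: "(E has_real_derivative \<tau> x) (at x)" "x \<le> 0 \<Longrightarrow> E x = 0" "\<epsilon> \<le> x \<Longrightarrow> E x = x - \<epsilon> / 2" for x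
    unfolding E_def \<tau>_def using smooth_ramp[OF \<epsilon>(1)] by auto
  have E_shift: "((\<lambda>t. E (t + d)) has_real_derivative \<tau> (t + d)) (at t)" for t d
  proof -
    have "((\<lambda>t. E (t + d)) has_real_derivative \<tau> (t + d) * 1) (at t)"
      by (rule DERIV_chain2[OF E(1)]) (auto intro!: derivative_eq_intros)
    then show ?thesis by simp
  qed
  define \<phi> where "\<phi> = (\<lambda>t. E (t + - a) - E (t + - b) - (E (t + (b + 1 - a)) - E (t + 1)))"
  define D where "D = (\<lambda>t. \<tau> (t + - a) - \<tau> (t + - b) - (\<tau> (t + (b + 1 - a)) - \<tau> (t + 1)))"
  have D: "(\<phi> has_real_derivative D t) (at t)" for t
    unfolding \<phi>_def D_def by (intro DERIV_diff E_shift)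
  have "continuous_on UNIV D"
    unfolding D_def \<tau>_def using \<epsilon> by (intro continuous_intros) auto
  show thesis
  proof
    show "\<phi> C1_differentiable_on UNIV"
      using D \<open>continuous_on UNIV D\<close>
      by (auto simp: C1_differentiable_on_def has_real_derivative_iff_has_vector_derivative)
    \<comment> \<open>To the right of \<open>b + 1\<close> the four antiderivatives are affine with slope \<open>1\<close> and cancel.\<close>
    have "\<phi> t = 0" if "b + 1 < \<bar>t\<bar>" for t
    proof (cases "t < 0")
      case True
      then show ?thesis using that ab by (simp add: \<phi>_def E(2))
    next
      case False
      then show ?thesis using that ab \<epsilon> by (simp add: \<phi>_def E(3))
    qed
    then show "bounded {t. \<phi> t \<noteq> 0}"
      by (intro boundedI[of _ "b + 1"]) force
    fix t :: real assume "0 \<le> t"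
    then have "\<tau> (t + (b + 1 - a)) = 1" "\<tau> (t + 1) = 1"
      using ab \<epsilon> by (auto simp: \<tau>_def min_absorb1 le_divide_eq_1_pos)
    then show "deriv \<phi> t = max 0 (min 1 ((t - a) / \<epsilon>)) - max 0 (min 1 ((t - b) / \<epsilon>))"
      using DERIV_imp_deriv[OF D[of t]] by (simp add: D_def \<tau>_def)
  qed
qed

text \<open>
  Lebesgue differentiation: almost everywhere \<open>g\<close> is the limit of its averages over \<open>[t,t+h]\<close>.
\<close>

lemma AE_zero_if_primitive_zero:
  assumes g: "L1_loc g" and 0: "\<And>t. 0 \<le> t \<Longrightarrow> primitive g t = 0"
  shows "AE t in lborel. 0 \<le> t \<longrightarrow> g t = 0"
proof -
  define f where "f = (\<lambda>t. if t \<in> {0..} then g t else 0)"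
  have int: "f integrable_on {a..b}" "0 \<le> a \<Longrightarrow> a \<le> b \<Longrightarrow> integral {a..b} f = 0" for a b
  proof -
    have *: "set_integrable lborel ({a..b} \<inter> {0..}) g"
      by (rule L1_loc_set_integrable[OF g, of _ b]) auto
    have "g integrable_on ({0..} \<inter> {a..b})"
      using set_borel_integral_eq_integral(1)[OF *] by (simp add: Int_commute)
    then show "f integrable_on {a..b}"
      unfolding f_def by (subst integrable_restrict_Int)
    assume "0 \<le> a" "a \<le> b"
    then have "(LBINT s:{a..b}. g s) = 0" and **: "{a..b} \<inter> {0..} = {a..b}"
      using primitive_diff_eq[OF g, of a b] 0[of a] 0[of b] by auto
    moreover have "integral {a..b} f = integral {a..b} g"
      using \<open>0 \<le> a\<close> by (intro integral_cong) (auto simp: f_def)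
    ultimately show "integral {a..b} f = 0"
      using set_borel_integral_eq_integral(2)[OF *] unfolding ** by simp
  qed
  obtain N where N: "negligible N" "\<And>x e. \<lbrakk>x \<notin> N; 0 < e\<rbrakk> \<Longrightarrow>
      \<exists>d>0. \<forall>h. 0 < h \<and> h < d \<longrightarrow>
        norm (integral (cbox x (x + h *\<^sub>R One)) f /\<^sub>R h ^ DIM(real) - f x) < e"
    using integrable_ccontinuous_explicit[of f] int(1) by (auto simp: cbox_interval)
  have "f x = 0" if "x \<notin> N" "0 \<le> x" for x
  proof (rule ccontr)
    assume "f x \<noteq> 0"
    with N(2)[OF that(1), of "\<bar>f x\<bar>"] obtain d where d: "d > 0"
      "\<And>h. 0 < h \<Longrightarrow> h < d \<Longrightarrow> norm (integral (cbox x (x + h *\<^sub>R One)) f /\<^sub>R h ^ DIM(real) - f x) < \<bar>f x\<bar>"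
      by auto
    from d(2)[of "d / 2"] d(1) int(2)[of x "x + d / 2"] that(2) show False
      by (simp add: cbox_interval)
  qed
  moreover have "AE x in lborel. x \<notin> N"
    using N(1) unfolding negligible_iff_null_sets
    by (subst AE_completion_iff[symmetric]) (rule AE_not_in)
  ultimately show ?thesis
    by (auto simp: f_def elim!: eventually_mono)
qed

text \<open>
  Testing with the ramps of width \<open>1/(n+1)\<close> and letting \<open>n\<close> tend to infinity shows that the indefinite
  integral of \<open>g\<close> vanishes.
\<close>

lemma fundamental_lemma_halfline:
  assumes g: "L1_loc g"
    and 0: "\<And>\<phi>. \<phi> C1_differentiable_on UNIV \<Longrightarrow> bounded {t. \<phi> t \<noteq> 0} \<Longrightarrow>
              (LBINT s:{0..}. g s * deriv \<phi> s) = 0"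
  shows "AE t in lborel. 0 \<le> t \<longrightarrow> g t = 0"
proof (rule AE_zero_if_primitive_zero[OF g])
  fix b :: real assume "0 \<le> b"
  have [measurable]: "g \<in> borel_measurable borel" using g by (simp add: L1_loc_def)
  show "primitive g b = 0"
  proof (cases "b = 0")
    case False
    with \<open>0 \<le> b\<close> have "0 < b" by simp
    define \<rho> where "\<rho> = (\<lambda>n t::real. max 0 (min 1 (t / (1 / real (Suc n)))))"
    define h where "h = (\<lambda>n t. \<rho> n (t - 0) - \<rho> n (t - b))"
    have [measurable]: "h n \<in> borel_measurable borel" for n unfolding h_def \<rho>_def by measurable
    have \<rho>0: "\<rho> n x = 0" if "x \<le> 0" for n x
    proof -
      have "x / (1 / real (Suc n)) \<le> 0" using that by (rule divide_nonpos_pos) simp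
      then show ?thesis unfolding \<rho>_def by linarith
    qed
    have \<rho>1: "\<rho> n x = 1" if "1 / real (Suc n) \<le> x" for n x
    proof -
      have "1 \<le> x / (1 / real (Suc n))" using that by (subst le_divide_eq_1_pos) auto
      then show ?thesis unfolding \<rho>_def by linarith
    qed
    have zero: "(LBINT s:{0..}. g s * h n s) = 0" for n
    proof -
      obtain \<phi> where \<phi>: "\<phi> C1_differentiable_on UNIV" "bounded {t. \<phi> t \<noteq> 0}"
        "\<And>t. 0 \<le> t \<Longrightarrow> deriv \<phi> t = h n t"
        using ramp_difference_test_function[of "1 / real (Suc n)" 0 b] \<open>0 < b\<close>
        unfolding h_def \<rho>_def by auto
      have "(LBINT s:{0..}. g s * h n s) = (LBINT s:{0..}. g s * deriv \<phi> s)"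
        unfolding set_lebesgue_integral_def
        by (intro Bochner_Integration.integral_cong) (auto simp: indicator_def \<phi>(3))
      with 0[OF \<phi>(1,2)] show ?thesis by simp
    qed
    have lim: "(\<lambda>n. indicat_real {0..} t *\<^sub>R (g t * h n t)) \<longlonglongrightarrow> indicat_real {0<..b} t *\<^sub>R g t" for t
    proof (rule tendsto_eventually)
      have ev: "\<forall>\<^sub>F n in sequentially. 1 / real (Suc n) < x" if "0 < x" for x :: real
        using order_tendstoD(2)[OF LIMSEQ_inverse_real_of_nat that] by (simp add: inverse_eq_divide)
      consider "t \<le> 0" | "0 < t" "t \<le> b" | "b < t" by linarith
      then show "\<forall>\<^sub>F n in sequentially. indicat_real {0..} t *\<^sub>R (g t * h n t) = indicat_real {0<..b} t *\<^sub>R g t"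
      proof cases
        case 1
        then have "indicat_real {0..} t *\<^sub>R (g t * h n t) = indicat_real {0<..b} t *\<^sub>R g t" for n
          using \<open>0 < b\<close> by (simp add: h_def \<rho>0)
        then show ?thesis by simp
      next
        case 2
        from ev[OF 2(1)] show ?thesis
          by eventually_elim (use 2 in \<open>simp add: h_def \<rho>0 \<rho>1\<close>)
      next
        case 3
        then have "0 < t - b" by simp
        from ev[OF this] show ?thesis
          by eventually_elim (use 3 \<open>0 < b\<close> in \<open>simp add: h_def \<rho>1\<close>)
      qed
    qed
    have bound: "norm (indicat_real {0..} t *\<^sub>R (g t * h n t)) \<le> \<bar>indicat_real {0..b+1} t *\<^sub>R g t\<bar>" for n t
    proof -
      have "\<bar>h n t\<bar> \<le> 1" unfolding h_def \<rho>_def by linarith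
      moreover have "h n t = 0" if "b + 1 < t"
      proof -
        have "1 / real (Suc n) \<le> 1" by simp
        with that \<open>0 < b\<close> show ?thesis by (simp only: h_def) (subst \<rho>1, linarith, subst \<rho>1, linarith, simp)
      qed
      ultimately show ?thesis
        by (auto simp: indicator_def abs_mult intro!: mult_left_le)
    qed
    have "(\<lambda>n. LBINT s. indicat_real {0..} s *\<^sub>R (g s * h n s)) \<longlonglongrightarrow> (LBINT s. indicat_real {0<..b} s *\<^sub>R g s)"
    proof (rule integral_dominated_convergence[where w="\<lambda>t. \<bar>indicat_real {0..b+1} t *\<^sub>R g t\<bar>"])
      show "integrable lborel (\<lambda>t. \<bar>indicat_real {0..b+1} t *\<^sub>R g t\<bar>)"
        using g by (intro integrable_abs) (auto simp: L1_loc_def set_integrable_def)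
    qed (use lim bound in \<open>auto intro!: AE_I2\<close>)
    then have "(LBINT s. indicat_real {0<..b} s *\<^sub>R g s) = 0"
      using zero unfolding set_lebesgue_integral_def by (simp add: LIMSEQ_const_iff)
    moreover have "AE t in lborel. indicat_real {0<..b} t *\<^sub>R g t = indicat_real {0..b} t *\<^sub>R g t"
      using AE_lborel_singleton[of 0] by eventually_elim (auto simp: indicator_def)
    ultimately show ?thesis
      unfolding primitive_def set_lebesgue_integral_def
      by (subst integral_cong_AE[symmetric]) auto
  qed (use g in simp)
qed

text \<open>
  This turns the distributional derivative into an integral equation, in both directions: the optimal
  pair is read through it, and competing pairs are shown to be admissible through it.
\<close>

lemma has_deriv_measure_iff:
  assumes k: "\<And>T. k absolutely_integrable_on {0..T}" and P: "radon_halfline P" and N: "radon_halfline N"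
  shows "has_deriv_measure k P N \<longleftrightarrow>
    (AE t in lborel. 0 \<le> t \<longrightarrow> k t = k 0 + measure P {0..t} - measure N {0..t})"
proof -
  obtain k' where k': "L1_loc k'" "AE t in lborel. 0 \<le> t \<longrightarrow> k t = k' t"
    using L1_loc_representative[OF k] by blast
  define g where "g = (\<lambda>t. k' t - (k 0 + (measure P {0..t} - measure N {0..t})))"
  have g: "L1_loc g"
    unfolding g_def by (intro L1_loc_diff L1_loc_add k' L1_loc_const L1_loc_measure_radon P N)
  have test: "(LINT t|P. \<phi> t) - (LINT t|N. \<phi> t) =
          - (\<phi> 0 * k 0) - (LINT t:{0..}|lebesgue. k t * deriv \<phi> t) \<longleftrightarrow> (LBINT s:{0..}. g s * deriv \<phi> s) = 0"
    if \<phi>: "\<phi> C1_differentiable_on UNIV" "bounded {t. \<phi> t \<noteq> 0}" for \<phi>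
  proof -
    obtain R where R: "0 < R" "\<And>t. R \<le> t \<Longrightarrow> \<phi> t = 0" "\<And>t. R \<le> t \<Longrightarrow> deriv \<phi> t = 0"
      "\<And>t. (\<phi> has_real_derivative deriv \<phi> t) (at t)" "continuous_on UNIV (deriv \<phi>)"
      using test_function[OF \<phi>] by blast
    have [measurable]: "deriv \<phi> \<in> borel_measurable borel" "k' \<in> borel_measurable borel"
      using R(5) k' by (auto intro: borel_measurable_continuous_onI simp: L1_loc_def)
    have 1: "(LINT t:{0..}|lebesgue. k t * deriv \<phi> t) = (LBINT t:{0..}. k' t * deriv \<phi> t)"
      using k'(2) by (intro set_integral_lebesgue_representative) (auto elim: eventually_mono)
    have "- \<phi> 0 = primitive (deriv \<phi>) R"
      using primitive_deriv(1)[OF R(4,5), of R] R(1,2) by simp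
    also have "\<dots> = (LBINT t:{0..}. deriv \<phi> t)"
      unfolding primitive_def set_lebesgue_integral_def
      by (intro Bochner_Integration.integral_cong) (auto simp: indicator_def R(3))
    finally have "(LBINT t:{0..}. deriv \<phi> t) = - \<phi> 0" by simp
    then have 2: "- (\<phi> 0 * k 0) = (LBINT t:{0..}. k 0 * deriv \<phi> t)" by simp
    have "(LBINT s:{0..}. g s * deriv \<phi> s) = (LBINT s:{0..}. k' s * deriv \<phi> s -
       (k 0 * deriv \<phi> s + (measure P {0..s} * deriv \<phi> s - measure N {0..s} * deriv \<phi> s)))"
      by (simp add: g_def algebra_simps)
    also have "\<dots> = (LBINT s:{0..}. k' s * deriv \<phi> s) - ((LBINT t:{0..}. k 0 * deriv \<phi> t) +
        ((LBINT s:{0..}. measure P {0..s} * deriv \<phi> s) - (LBINT s:{0..}. measure N {0..s} * deriv \<phi> s)))"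
      by (simp only: set_integral_diff set_integral_add L1_loc_integrable_test_function[OF _ \<phi>]
          k'(1) L1_loc_const L1_loc_measure_radon[OF P] L1_loc_measure_radon[OF N])
    finally show ?thesis
      unfolding radon_integral_test_function[OF P \<phi>] radon_integral_test_function[OF N \<phi>] 1 2 by auto
  qed
  have [measurable]: "g \<in> borel_measurable borel" using g by (simp add: L1_loc_def)
  have "has_deriv_measure k P N \<longleftrightarrow> (AE t in lborel. 0 \<le> t \<longrightarrow> g t = 0)"
  proof
    assume "has_deriv_measure k P N"
    then show "AE t in lborel. 0 \<le> t \<longrightarrow> g t = 0"
      by (intro fundamental_lemma_halfline[OF g]) (auto simp: has_deriv_measure_def test)
  next
    assume ae: "AE t in lborel. 0 \<le> t \<longrightarrow> g t = 0"
    then have "(LBINT s:{0..}. g s * deriv \<phi> s) = 0" for \<phi>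
      unfolding set_lebesgue_integral_def
      by (intro integral_eq_zero_AE) (auto simp: indicator_def)
    then show "has_deriv_measure k P N"
      using P N by (auto simp: has_deriv_measure_def test)
  qed
  also have "\<dots> \<longleftrightarrow> (AE t in lborel. 0 \<le> t \<longrightarrow> k t = k 0 + measure P {0..t} - measure N {0..t})"
    using k'(2) by (intro eventually_subst) (auto simp: g_def elim!: eventually_mono)
  finally show ?thesis .
qed

section \<open>Concave utility functions\<close>

text \<open>
  Slopes of a concave function decrease, written without divisions so that the points may coincide.
\<close>

lemma concave_three_chord:
  fixes g :: "real \<Rightarrow> real"
  assumes "concave_on {0..} g" "0 \<le> a" "a \<le> b" "b \<le> c"
  shows "(b - a) * (g c - g b) \<le> (c - b) * (g b - g a)"
proof (cases "a < c")
  case True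
  define t where "t = (b - a) / (c - a)"
  have "t * (c - a) = b - a" using True by (simp add: t_def)
  then have "(1 - t) * a + t * c = b" by (simp add: algebra_simps)
  with True assms have t: "0 \<le> t" "t \<le> 1" "(1 - t) * a + t * c = b"
    by (auto simp: t_def field_simps)
  have "(1 - t) * g a + t * g c \<le> g b"
    using concave_onD[OF assms(1) t(1,2), of a c] assms t(3) by simp
  then have "((1 - t) * g a + t * g c) * (c - a) \<le> g b * (c - a)"
    using True by (intro mult_right_mono) auto
  moreover have "((1 - t) * g a + t * g c) * (c - a) = (c - a - t * (c - a)) * g a + t * (c - a) * g c"
    by (simp add: algebra_simps)
  ultimately have "(c - b) * g a + (b - a) * g c \<le> g b * (c - a)"
    using \<open>t * (c - a) = b - a\<close> by simp
  then show ?thesis by (simp add: algebra_simps)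
next
  case False
  with assms have "a = b" "b = c" by auto
  then show ?thesis by simp
qed

context
  fixes U :: "real \<Rightarrow> real"
  assumes U: "utility U"
begin

lemma utility_nonneg: "0 \<le> x \<Longrightarrow> 0 \<le> U x"
  and utility_concave: "concave_on {0..} U"
  and utility_less: "0 \<le> x \<Longrightarrow> x < y \<Longrightarrow> U x < U y"
  and utility_mono: "0 \<le> x \<Longrightarrow> x \<le> y \<Longrightarrow> U x \<le> U y"
proof -
  show "0 \<le> x \<Longrightarrow> 0 \<le> U x" "concave_on {0..} U"
    using U unfolding utility_def by blast+
  show less: "0 \<le> x \<Longrightarrow> x < y \<Longrightarrow> U x < U y" for x y
    using U unfolding utility_def strict_mono_on_def by simp
  show "0 \<le> x \<Longrightarrow> x \<le> y \<Longrightarrow> U x \<le> U y"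
    using less[of x y] by (cases "x = y") auto
qed

text \<open>
  Densities are nonnegative only almost everywhere, and nothing is known about \<open>U\<close> on \<open>(-\<infinity>,0)\<close>;
  truncating the argument at \<open>0\<close> gives an everywhere monotone function.
\<close>

lemma utility_measurable [measurable]: "(\<lambda>x. U (max 0 x)) \<in> borel_measurable borel"
  by (rule borel_measurable_mono) (auto intro!: monoI utility_mono)

lemma utility_le_affine: "0 \<le> x \<Longrightarrow> U x \<le> U 1 * (1 + x)"
proof -
  assume x: "0 \<le> x"
  have "0 \<le> U 0" "U 0 \<le> U 1" using utility_nonneg[of 0] utility_mono[of 0 1] by auto
  show ?thesis
  proof (cases "x \<le> 1")
    case True
    have "U x \<le> U 1" using True x utility_mono by auto
    also have "U 1 * 1 \<le> U 1 * (1 + x)"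
      using x \<open>0 \<le> U 0\<close> \<open>U 0 \<le> U 1\<close> by (intro mult_left_mono) auto
    finally show ?thesis by simp
  next
    case False
    then have "U x - U 1 \<le> (x - 1) * (U 1 - U 0)"
      using concave_three_chord[OF utility_concave, of 0 1 x] by simp
    also have "\<dots> \<le> (x - 1) * U 1" using False \<open>0 \<le> U 0\<close> by (intro mult_left_mono) auto
    finally show ?thesis using \<open>0 \<le> U 0\<close> \<open>U 0 \<le> U 1\<close> by (simp add: algebra_simps)
  qed
qed

lemma utility_increment_antimono:
  assumes "0 \<le> x" "x \<le> y" "0 \<le> h"
  shows "U (y + h) - U y \<le> U (x + h) - U x"
proof (cases "h = 0")
  case False
  with assms have "0 < h" by simp
  define d where "d = y - x"
  have *: "h * (U (y + h) - U (x + h)) \<le> d * (U (x + h) - U x)"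
    using concave_three_chord[OF utility_concave, of x "x + h" "y + h"] assms by (simp add: d_def)
  have **: "d * (U (y + h) - U y) \<le> h * (U y - U x)"
    using concave_three_chord[OF utility_concave, of x y "y + h"] assms by (simp add: d_def)
  have "(d + h) * (U (y + h) - U y) \<le> (d + h) * (U (x + h) - U x)"
    using * ** by (simp add: algebra_simps)
  moreover have "0 < d + h" using \<open>0 < h\<close> assms by (simp add: d_def)
  ultimately show ?thesis by simp
qed simp

text \<open>
  The difference quotient increases as \<open>y\<close> decreases to \<open>x\<close> and is bounded by the slopes to the left of
  \<open>x\<close>, so that it converges to its supremum.
\<close>

lemma right_deriv_utility_bounds:
  assumes x: "0 < x"
  shows "x < y \<Longrightarrow> (U y - U x) / (y - x) \<le> right_deriv U x"
    and "\<lbrakk>0 \<le> z; z < x\<rbrakk> \<Longrightarrow> right_deriv U x \<le> (U x - U z) / (x - z)"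
proof -
  let ?g = "\<lambda>y. (U y - U x) / (y - x)"
  let ?L = "SUP y\<in>{x<..}. ?g y"
  have anti: "?g z \<le> ?g y" if "x < y" "y \<le> z" for y z
  proof -
    have "(y - x) * (U z - U y) \<le> (z - y) * (U y - U x)"
      using concave_three_chord[OF utility_concave, of x y z] that x by simp
    then have "(y - x) * (U z - U x) \<le> (z - x) * (U y - U x)" by (simp add: algebra_simps)
    with that show ?thesis by (simp add: divide_le_eq le_divide_eq mult_ac)
  qed
  have bd: "?g y \<le> (U x - U z) / (x - z)" if "0 \<le> z" "z < x" "x < y" for y z
    using concave_three_chord[OF utility_concave, of z x y] that
    by (simp add: divide_le_eq le_divide_eq mult_ac)
  have bdd: "bdd_above (?g ` {x<..})"
    using bd[of 0] x by (intro bdd_aboveI[of _ "(U x - U 0) / (x - 0)"]) auto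
  have up: "?g y \<le> ?L" if "x < y" for y
    using that bdd by (intro cSUP_upper) auto
  have lim: "(?g \<longlongrightarrow> ?L) (at_right x)"
  proof (rule order_tendstoI)
    fix a assume "a < ?L"
    then obtain y where y: "x < y" "a < ?g y"
      using less_cSUP_iff[OF _ bdd, of a] by auto
    then show "\<forall>\<^sub>F z in at_right x. a < ?g z"
      unfolding eventually_at_right_field
      by (intro exI[of _ y] conjI allI impI less_le_trans[OF y(2)] anti) auto
  next
    fix a assume "?L < a"
    then show "\<forall>\<^sub>F z in at_right x. ?g z < a"
      unfolding eventually_at_right_field
      by (intro exI[of _ "x + 1"] conjI allI impI le_less_trans[OF up]) auto
  qed
  then have "(U has_vector_derivative ?L) (at_right x)"
    by (simp add: has_field_derivative_iff flip: has_real_derivative_iff_has_vector_derivative)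
  then have L: "right_deriv U x = ?L"
    unfolding right_deriv_def by (intro vector_derivative_within) auto
  show "x < y \<Longrightarrow> ?g y \<le> right_deriv U x" using up L by simp
  show "\<lbrakk>0 \<le> z; z < x\<rbrakk> \<Longrightarrow> right_deriv U x \<le> (U x - U z) / (x - z)"
    unfolding L using bd by (intro cSUP_least) auto
qed

lemma right_deriv_utility_pos: "0 < x \<Longrightarrow> 0 < right_deriv U x"
  using right_deriv_utility_bounds(1)[of x "x + 1"] utility_less[of x "x + 1"] by simp

text \<open>
  Evaluating the marginal utility at \<open>2b\<close> instead of \<open>b\<close> makes the estimate valid for every increment
  up to \<open>b\<close>; finite perturbations then suffice in all comparisons below.
\<close>

lemma utility_gain:
  assumes "0 \<le> x" "x \<le> b" "0 < b" "0 \<le> h" "h \<le> b"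
  shows "h * right_deriv U (2 * b) \<le> U (x + h) - U x"
proof (cases "h = 0")
  case False
  with assms have h: "0 < h" by simp
  have "right_deriv U (2 * b) \<le> (U (2 * b) - U (2 * b - h)) / (2 * b - (2 * b - h))"
    using assms h by (intro right_deriv_utility_bounds) auto
  then have "h * right_deriv U (2 * b) \<le> U (2 * b - h + h) - U (2 * b - h)"
    using h by (simp add: le_divide_eq mult_ac)
  also have "\<dots> \<le> U (x + h) - U x"
    using assms by (intro utility_increment_antimono) auto
  finally show ?thesis .
qed simp

lemma utility_loss:
  assumes "0 < a" "a \<le> x" "0 \<le> h" "h \<le> a / 2"
  shows "U x - U (x - h) \<le> h * right_deriv U (a / 2)"
proof (cases "h = 0")
  case False
  with assms have h: "0 < h" by simp
  have "(U (a / 2 + h) - U (a / 2)) / ((a / 2 + h) - a / 2) \<le> right_deriv U (a / 2)"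
    using assms h by (intro right_deriv_utility_bounds) auto
  then have "U (a / 2 + h) - U (a / 2) \<le> h * right_deriv U (a / 2)"
    using h by (simp add: divide_le_eq mult_ac)
  moreover have "U (x - h + h) - U (x - h) \<le> U (a / 2 + h) - U (a / 2)"
    using assms by (intro utility_increment_antimono) auto
  ultimately show ?thesis by simp
qed simp

lemma utility_scale:
  assumes "0 \<le> \<theta>" "\<theta> \<le> 1" "0 \<le> x"
  shows "(1 - \<theta>) * U x \<le> U ((1 - \<theta>) * x)"
proof -
  have "(1 - \<theta>) * U x + \<theta> * U 0 \<le> U ((1 - \<theta>) * x)"
    using concave_onD[OF utility_concave, of \<theta> x 0] assms by simp
  moreover have "0 \<le> \<theta> * U 0" using assms utility_nonneg by simp
  ultimately show ?thesis by simp
qed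

lemma marginal_utility_at_0: "\<exists>b>0. q < right_deriv U (2 * b)"
proof -
  have "filterlim (right_deriv U) at_top (at_right 0)" using U by (simp add: utility_def)
  then have "eventually (\<lambda>x. q < right_deriv U x) (at_right 0)" by (simp add: filterlim_at_top_dense)
  then obtain e where "0 < e" "\<And>x. 0 < x \<Longrightarrow> x < e \<Longrightarrow> q < right_deriv U x"
    by (auto simp: eventually_at_right_field)
  then show ?thesis by (intro exI[of _ "e / 4"]) auto
qed

lemma marginal_utility_at_top: "0 < q \<Longrightarrow> \<exists>a>0. right_deriv U (a / 2) < q"
proof -
  assume "0 < q"
  have "(right_deriv U \<longlongrightarrow> 0) at_top" using U by (simp add: utility_def)
  then have "eventually (\<lambda>x. right_deriv U x < q) at_top" using \<open>0 < q\<close> by (rule order_tendstoD)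
  then obtain N where "\<And>x. N \<le> x \<Longrightarrow> right_deriv U x < q" by (auto simp: eventually_at_top_linorder)
  then show ?thesis by (intro exI[of _ "max 1 (2 * N)"]) auto
qed

end

section \<open>Measures with a density\<close>

lemma emeasure_measure_of_density:
  assumes c: "L1_loc c" "AE t in lborel. 0 \<le> t \<longrightarrow> 0 \<le> c t" and A: "A \<in> sets borel" "A \<subseteq> {0..T}"
  shows "emeasure (measure_of_density c) A = ennreal (LBINT t:A. c t)"
proof -
  have [measurable]: "c \<in> borel_measurable borel" "A \<in> sets borel"
    using c A by (auto simp: L1_loc_def)
  have "emeasure (measure_of_density c) A = (\<integral>\<^sup>+t. ennreal (indicator A t *\<^sub>R c t) \<partial>lborel)"
    unfolding measure_of_density_def using A
    by (subst emeasure_density) (auto intro!: nn_integral_cong simp: indicator_def)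
  also have "\<dots> = ennreal (LBINT t:A. c t)"
    unfolding set_lebesgue_integral_def
  proof (rule nn_integral_eq_integral)
    show "integrable lborel (\<lambda>t. indicator A t *\<^sub>R c t)"
      using L1_loc_set_integrable[OF c(1) A] by (simp add: set_integrable_def)
    show "AE t in lborel. 0 \<le> indicator A t *\<^sub>R c t"
      using c(2) by eventually_elim (use A in \<open>auto simp: indicator_def\<close>)
  qed
  finally show ?thesis .
qed

lemma measure_measure_of_density:
  assumes c: "L1_loc c" "AE t in lborel. 0 \<le> t \<longrightarrow> 0 \<le> c t" and A: "A \<in> sets borel" "A \<subseteq> {0..T}"
  shows "measure (measure_of_density c) A = (LBINT t:A. c t)"
proof -
  have "0 \<le> (LBINT t:A. c t)"
    unfolding set_lebesgue_integral_def
    by (intro integral_nonneg_AE eventually_mono[OF c(2)]) (use A in \<open>auto simp: indicator_def\<close>)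
  then show ?thesis
    using emeasure_measure_of_density[OF assms] by (simp add: measure_def)
qed

lemma radon_measure_of_density:
  assumes c: "L1_loc c" "AE t in lborel. 0 \<le> t \<longrightarrow> 0 \<le> c t"
  shows "radon_halfline (measure_of_density c)"
  unfolding radon_halfline_def
proof (intro conjI allI)
  have [measurable]: "c \<in> borel_measurable borel" using c by (auto simp: L1_loc_def)
  show "sets (measure_of_density c) = sets borel" by (simp add: measure_of_density_def)
  show "emeasure (measure_of_density c) {..<0} = 0"
  proof -
    have "(\<integral>\<^sup>+t. ennreal (indicator {0..} t * c t) * indicator {..<0} t \<partial>lborel) = (\<integral>\<^sup>+t. 0 \<partial>(lborel::real measure))"
      by (intro nn_integral_cong) (simp add: indicator_def)
    then have "(\<integral>\<^sup>+t. ennreal (indicator {0..} t * c t) * indicator {..<0} t \<partial>lborel) = 0" by simp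
    then show ?thesis
      unfolding measure_of_density_def by (subst emeasure_density) simp_all
  qed
  show "emeasure (measure_of_density c) {0..T} < \<infinity>" for T
    using emeasure_measure_of_density[OF c, of "{0..T}" T] by simp
qed

text \<open>
  The exceptional set of the Lebesgue decomposition is Lebesgue null and hence carries no mass of a
  measure with a density, so any admissible choice of the density agrees with \<open>c\<close>.
\<close>

lemma ac_density_measure_of_density:
  assumes c: "L1_loc c" "AE t in lborel. 0 \<le> t \<longrightarrow> 0 \<le> c t"
  shows "AE t in lborel. 0 \<le> t \<longrightarrow> ac_density (measure_of_density c) t = c t"
    and "ac_density (measure_of_density c) \<in> borel_measurable borel"
    and "0 \<le> ac_density (measure_of_density c) t"
proof -
  have [measurable]: "c \<in> borel_measurable borel" using c by (auto simp: L1_loc_def)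
  let ?c = "\<lambda>t. indicator {0..} t * max 0 (c t)"
  let ?g = "ac_density (measure_of_density c)"
  have eq: "measure_of_density c = density lborel (\<lambda>t. ennreal (?c t))"
  proof -
    have "ennreal (indicator {0..} t * c t) = ennreal (?c t)" for t
      by (cases "0 \<le> c t") (simp_all add: indicator_def ennreal_neg)
    then show ?thesis unfolding measure_of_density_def by simp
  qed
  have "is_ac_density (measure_of_density c) ?c"
    unfolding is_ac_density_def
  proof (intro conjI allI bexI[of _ "{}"] ballI)
    fix A :: "real set" assume "A \<in> sets borel"
    then show "emeasure (measure_of_density c) A =
        (\<integral>\<^sup>+t\<in>A. ennreal (?c t) \<partial>lborel) + emeasure (measure_of_density c) (A \<inter> {})"
      unfolding eq by (subst emeasure_density) (auto simp: mult.commute)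
  qed auto
  then have g: "is_ac_density (measure_of_density c) ?g"
    unfolding ac_density_def by (rule someI[of "is_ac_density (measure_of_density c)"])
  then show [measurable]: "?g \<in> borel_measurable borel" and g0: "0 \<le> ?g t" for t
    by (auto simp: is_ac_density_def)
  from g obtain Z where Z: "Z \<in> null_sets lborel" "\<And>A. A \<in> sets borel \<Longrightarrow>
      emeasure (measure_of_density c) A = (\<integral>\<^sup>+t\<in>A. ennreal (?g t) \<partial>lborel) + emeasure (measure_of_density c) (A \<inter> Z)"
    by (auto simp: is_ac_density_def)
  have [measurable]: "Z \<in> sets borel" using Z(1) by auto
  have "emeasure (measure_of_density c) (A \<inter> Z) = 0" if [measurable]: "A \<in> sets borel" for A
  proof -
    have "A \<inter> Z \<in> null_sets lborel" using Z(1) that null_set_Int1[of Z lborel A] by (simp add: Int_commute)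
    then have "A \<inter> Z \<in> null_sets (measure_of_density c)"
      using absolutely_continuousI_density[of "\<lambda>t. ennreal (?c t)" lborel]
      unfolding eq absolutely_continuous_def by auto
    then show ?thesis by auto
  qed
  then have *: "emeasure (measure_of_density c) A = (\<integral>\<^sup>+t\<in>A. ennreal (?g t) \<partial>lborel)"
    if "A \<in> sets borel" for A using Z(2)[OF that] that by simp
  have "density lborel (\<lambda>t. ennreal (?g t)) = measure_of_density c"
  proof (rule measure_eqI)
    show "sets (density lborel (\<lambda>t. ennreal (?g t))) = sets (measure_of_density c)"
      by (simp add: measure_of_density_def)
    fix A assume "A \<in> sets (density lborel (\<lambda>t. ennreal (?g t)))"
    then have A: "A \<in> sets borel" by simp
    then show "emeasure (density lborel (\<lambda>t. ennreal (?g t))) A = emeasure (measure_of_density c) A"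
      unfolding *[OF A] by (subst emeasure_density) (simp_all add: mult.commute)
  qed
  then have "density lborel (\<lambda>t. ennreal (?g t)) = density lborel (\<lambda>t. ennreal (?c t))"
    unfolding eq .
  then have "AE t in lborel. ennreal (?g t) = ennreal (?c t)"
    by (subst (asm) sigma_finite_measure.density_unique_iff[OF sigma_finite_lborel]) auto
  then show "AE t in lborel. 0 \<le> t \<longrightarrow> ?g t = c t"
    using c(2) by eventually_elim (use g0 in \<open>auto simp: indicator_def\<close>)
qed

lemma J_inf_measure_of_density:
  assumes c: "L1_loc c" "AE t in lborel. 0 \<le> t \<longrightarrow> 0 \<le> c t"
  shows "J_inf U r (measure_of_density c) =
    (\<integral>\<^sup>+t. ennreal (indicator {0..} t * (exp (- r * t) * U (max 0 (c t)))) \<partial>lborel)"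
  unfolding J_inf_def
  using ac_density_measure_of_density(1)[OF c] c(2)
  by (intro nn_integral_cong_AE) (auto simp: indicator_def max_def elim!: eventually_elim2)

section \<open>The economy and the finiteness of its value\<close>

text \<open>
  The consequences of the assumptions on \<open>f\<close> that the argument uses, for externalities in \<open>I\<close> bounded
  by \<open>M\<close>.  Here \<open>\<delta>\<close> bounds the depreciation rate, \<open>F\<close> bounds the output, and \<open>f_small\<close> expresses that
  output tends to \<open>0\<close> with the capital, uniformly in the externality.  The marginal productivity may be
  infinite at zero capital, so no linear bound on the output is available there.
\<close>

locale growth_model =
  fixes f :: "real \<Rightarrow> real \<Rightarrow> real" and U :: "real \<Rightarrow> real" and I :: "real set"
    and r k0 M \<delta> F k1 :: real
  assumes utility: "utility U" and r: "0 < r" and k0: "0 < k0"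
    and \<delta>: "0 < \<delta>" and F: "0 \<le> F" and k1: "0 < k1"
    and f_cont: "continuous_on ({0..} \<times> {0..}) (\<lambda>(x, L). f x L)"
    and f_lower: "\<lbrakk>L \<in> I; 0 < L; 0 \<le> x; 0 \<le> h\<rbrakk> \<Longrightarrow> f x L - \<delta> * h \<le> f (x + h) L"
    and f_le: "\<lbrakk>L \<in> I; L \<le> M; 0 \<le> x\<rbrakk> \<Longrightarrow> f x L \<le> F"
    and f_0: "L \<in> I \<Longrightarrow> f 0 L = 0"
    and f_scale: "\<lbrakk>L \<in> I; 0 \<le> \<theta>; \<theta> \<le> 1; 0 \<le> x\<rbrakk> \<Longrightarrow> (1 - \<theta>) * f x L \<le> f ((1 - \<theta>) * x) L"
    and f_nonneg: "\<lbrakk>L \<in> I; 0 \<le> x; x < k1\<rbrakk> \<Longrightarrow> 0 \<le> f x L"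
    and f_small: "0 < \<eta> \<Longrightarrow> \<exists>x0>0. \<forall>L x. L \<in> I \<and> L \<le> M \<and> 0 \<le> x \<and> x \<le> x0 \<longrightarrow> f x L \<le> \<eta>"

begin

text \<open>
  Bounds the value of every plan, uniformly in the externality: \<open>U c \<le> U 1 * (1 + c)\<close>, and the discounted
  integral of \<open>1 + c\<close> is at most the second factor.
\<close>

definition J_max :: real where "J_max = U 1 * (1 / r + k0 + F / r)"

text \<open>
  The function \<open>b(t) = k0 + F t - \<integral>c\<close> is nonnegative; integrating the derivative of \<open>e\<^bsup>-rt\<^esup> b(t)\<close> bounds
  the discounted consumption by \<open>k0 + F / r\<close>.
\<close>

lemma primitive_discounted_le:
  assumes c: "L1_loc c" and le: "\<And>t. 0 \<le> t \<Longrightarrow> primitive c t \<le> k0 + F * t" and t: "0 \<le> t"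
  shows "primitive (\<lambda>s. exp (- r * s) * (1 + c s)) t \<le> 1 / r + k0 + F / r"
    and "L1_loc (\<lambda>s. exp (- r * s) * (1 + c s))"
proof -
  have exp_mult: "L1_loc (\<lambda>s. exp (- r * s) * u s)" if "L1_loc u" for u
    by (intro L1_loc_mult_continuous that continuous_intros)
  show "L1_loc (\<lambda>s. exp (- r * s) * (1 + c s))"
    by (intro exp_mult L1_loc_add L1_loc_const c)
  let ?b = "\<lambda>t. k0 + primitive (\<lambda>s. F - c s) t"
  have Fc: "L1_loc (\<lambda>s. F - c s)" by (intro L1_loc_diff L1_loc_const c)
  have b: "0 \<le> ?b s" if "0 \<le> s" for s
    using le[OF that] that by (simp add: primitive_diff[OF L1_loc_const c] primitive_const)
  have exp_eq: "r * primitive (\<lambda>s. exp (- r * s)) t = 1 - exp (- r * t)"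
    using primitive_exp(1)[OF t, of "- r"] unfolding primitive_cmult by simp
  have "0 \<le> exp (- r * t) * ?b t" using b[OF t] by simp
  also have "exp (- r * t) * ?b t = (1 + primitive (\<lambda>s. - r * exp (- r * s)) t) * ?b t"
    unfolding primitive_exp(1)[OF t, of "- r", symmetric] ..
  also have "\<dots> = k0 + primitive (\<lambda>s. (1 + primitive (\<lambda>s. - r * exp (- r * s)) s) * (F - c s) + ?b s * (- r * exp (- r * s))) t"
    using primitive_product_rule[OF primitive_exp(2)[of 0 "- r"] Fc t, of 1 k0] by simp
  also have "primitive (\<lambda>s. (1 + primitive (\<lambda>s. - r * exp (- r * s)) s) * (F - c s) + ?b s * (- r * exp (- r * s))) t
      = primitive (\<lambda>s. (1 + F) * exp (- r * s) - exp (- r * s) * (1 + c s) - r * (exp (- r * s) * ?b s)) t"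
  proof (rule primitive_cong)
    fix s :: real assume "0 \<le> s"
    then show "(1 + primitive (\<lambda>s. - r * exp (- r * s)) s) * (F - c s) + ?b s * (- r * exp (- r * s))
      = (1 + F) * exp (- r * s) - exp (- r * s) * (1 + c s) - r * (exp (- r * s) * ?b s)"
      unfolding primitive_exp(1)[OF \<open>0 \<le> s\<close>, of "- r", symmetric] by (simp add: algebra_simps)
  qed
  also have "\<dots> = (1 + F) * primitive (\<lambda>s. exp (- r * s)) t - primitive (\<lambda>s. exp (- r * s) * (1 + c s)) t
      - r * primitive (\<lambda>s. exp (- r * s) * ?b s) t"
    unfolding primitive_cmult[symmetric]
    by (subst primitive_diff[symmetric] | intro L1_loc_diff L1_loc_cmult exp_mult L1_loc_add L1_loc_const c
        L1_loc_primitive Fc primitive_exp(3)[of 0] order_refl refl)+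
  finally have "primitive (\<lambda>s. exp (- r * s) * (1 + c s)) t \<le>
      k0 + (1 + F) * primitive (\<lambda>s. exp (- r * s)) t - r * primitive (\<lambda>s. exp (- r * s) * ?b s) t" by simp
  moreover have "0 \<le> r * primitive (\<lambda>s. exp (- r * s) * ?b s) t"
    using b r by (intro mult_nonneg_nonneg primitive_nonneg AE_I2) auto
  moreover have "primitive (\<lambda>s. exp (- r * s)) t \<le> 1 / r"
  proof -
    have "r * primitive (\<lambda>s. exp (- r * s)) t \<le> 1" unfolding exp_eq by simp
    then show ?thesis using r by (simp only: pos_le_divide_eq mult.commute)
  qed
  then have "(1 + F) * primitive (\<lambda>s. exp (- r * s)) t \<le> (1 + F) * (1 / r)"
    using F by (intro mult_left_mono) auto
  moreover have "(1 + F) * (1 / r) = 1 / r + F / r" by (simp add: add_divide_distrib)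
  ultimately show "primitive (\<lambda>s. exp (- r * s) * (1 + c s)) t \<le> 1 / r + k0 + F / r"
    by linarith
qed

lemma discounted_utility_bound:
  assumes c: "L1_loc c" and c0: "AE t in lborel. 0 \<le> t \<longrightarrow> 0 \<le> c t"
    and le: "\<And>t. 0 \<le> t \<Longrightarrow> primitive c t \<le> k0 + F * t"
  shows "(\<integral>\<^sup>+t. ennreal (indicator {0..} t * (exp (- r * t) * U (max 0 (c t)))) \<partial>lborel) \<le> ennreal J_max"
proof -
  have [measurable]: "c \<in> borel_measurable borel" using c by (simp add: L1_loc_def)
  note utility_measurable[OF utility, measurable]
  let ?h = "\<lambda>t. exp (- r * t) * U (max 0 (c t))"
  let ?v = "\<lambda>t. exp (- r * t) * (1 + c t)"
  have U1: "0 \<le> U 1" using utility_nonneg[OF utility, of 1] by simp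
  have v: "L1_loc ?v" by (rule primitive_discounted_le(2)[OF c le order_refl])
  have n: "(\<integral>\<^sup>+t. ennreal (indicator {0..real n} t * ?h t) \<partial>lborel) \<le> ennreal J_max" for n
  proof -
    have "(\<integral>\<^sup>+t. ennreal (indicator {0..real n} t * ?h t) \<partial>lborel) \<le>
        (\<integral>\<^sup>+t. ennreal (U 1 * (indicator {0..real n} t *\<^sub>R ?v t)) \<partial>lborel)"
    proof (rule nn_integral_mono_AE, use c0 in eventually_elim)
      case (elim t)
      show "ennreal (indicator {0..real n} t * ?h t) \<le> ennreal (U 1 * (indicator {0..real n} t *\<^sub>R ?v t))"
      proof (cases "t \<in> {0..real n}")
        case True
        then have "U (max 0 (c t)) \<le> U 1 * (1 + c t)" using elim utility_le_affine[OF utility, of "c t"] by simp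
        then have "exp (- r * t) * U (max 0 (c t)) \<le> exp (- r * t) * (U 1 * (1 + c t))"
          by (intro mult_left_mono) auto
        with True show ?thesis by (intro ennreal_leI) (simp add: mult_ac)
      qed simp
    qed
    also have "\<dots> = ennreal (LBINT t. U 1 * (indicator {0..real n} t *\<^sub>R ?v t))"
    proof (rule nn_integral_eq_integral)
      show "integrable lborel (\<lambda>t. U 1 * (indicator {0..real n} t *\<^sub>R ?v t))"
        using v by (intro integrable_mult_right) (auto simp: L1_loc_def set_integrable_def)
      show "AE t in lborel. 0 \<le> U 1 * (indicator {0..real n} t *\<^sub>R ?v t)"
        using c0 by eventually_elim (use U1 in \<open>auto simp: indicator_def\<close>)
    qed
    also have "(LBINT t. U 1 * (indicator {0..real n} t *\<^sub>R ?v t)) = U 1 * primitive ?v (real n)"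
      by (simp add: primitive_def set_lebesgue_integral_def)
    also have "ennreal (U 1 * primitive ?v (real n)) \<le> ennreal J_max"
      unfolding J_max_def using U1 primitive_discounted_le(1)[OF c le, of "real n"]
      by (intro ennreal_leI mult_left_mono) auto
    finally show ?thesis .
  qed
  have h0: "0 \<le> ?h t" for t using utility_nonneg[OF utility, of "max 0 (c t)"] by simp
  have "(\<integral>\<^sup>+t. ennreal (indicator {0..} t * ?h t) \<partial>lborel) =
      (\<integral>\<^sup>+t. (SUP n. ennreal (indicator {0..real n} t * ?h t)) \<partial>lborel)"
  proof (rule nn_integral_cong)
    fix t :: real
    obtain m :: nat where m: "t \<le> real m" using real_arch_simple by blast
    show "ennreal (indicator {0..} t * ?h t) = (SUP n. ennreal (indicator {0..real n} t * ?h t))"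
    proof (rule antisym)
      have "ennreal (indicator {0..} t * ?h t) = ennreal (indicator {0..real m} t * ?h t)"
        using m by (simp add: indicator_def)
      also have "\<dots> \<le> (SUP n. ennreal (indicator {0..real n} t * ?h t))" by (rule SUP_upper) simp
      finally show "ennreal (indicator {0..} t * ?h t) \<le> (SUP n. ennreal (indicator {0..real n} t * ?h t))" .
      show "(SUP n. ennreal (indicator {0..real n} t * ?h t)) \<le> ennreal (indicator {0..} t * ?h t)"
        by (intro SUP_least ennreal_leI mult_right_mono h0) (simp add: indicator_def)
    qed
  qed
  also have "\<dots> = (SUP n. \<integral>\<^sup>+t. ennreal (indicator {0..real n} t * ?h t) \<partial>lborel)"
  proof (rule nn_integral_monotone_convergence_SUP)
    show "incseq (\<lambda>n t. ennreal (indicator {0..real n} t * ?h t))"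
      by (intro incseq_SucI le_funI ennreal_leI mult_right_mono h0) (simp add: indicator_def)
  qed measurable
  also have "\<dots> \<le> ennreal J_max" by (rule SUP_least) (rule n)
  finally show ?thesis .
qed

end

section \<open>Admissible pairs and deferred consumption\<close>

locale environment = growth_model +
  fixes K :: "real \<Rightarrow> real"
  assumes K_measurable: "K \<in> borel_measurable (lebesgue_on {0..})"
    and K: "\<And>t. 0 \<le> t \<Longrightarrow> 0 < K t" "\<And>t. 0 \<le> t \<Longrightarrow> K t \<in> I" "\<And>t. 0 \<le> t \<Longrightarrow> K t \<le> M"

begin

lemma output_bounds:
  assumes "0 \<le> t" "0 \<le> x"
  shows "- (\<delta> * x) \<le> f x (K t)" "f x (K t) \<le> F"
  using f_lower[of "K t" 0 x] f_0[of "K t"] f_le[of "K t" x] K assms by auto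

text \<open>
  The output along a given capital path lies between \<open>- \<delta> k\<close> and \<open>F\<close>, so it is locally integrable.
\<close>

lemma output_representative:
  assumes k: "\<And>T. k absolutely_integrable_on {0..T}" "AE t in lborel. 0 \<le> t \<longrightarrow> 0 \<le> k t"
  obtains y where "L1_loc y" "AE t in lborel. 0 \<le> t \<longrightarrow> y t = f (k t) (K t)"
proof -
  obtain k' where k': "L1_loc k'" "AE t in lborel. 0 \<le> t \<longrightarrow> k t = k' t"
    using L1_loc_representative[OF k(1)] by blast
  have "(\<lambda>t. indicat_real {0..} t *\<^sub>R K t) \<in> borel_measurable lebesgue"
    using K_measurable by (subst (asm) borel_measurable_restrict_space_iff) auto
  from completion_ex_borel_measurable_real[OF this] obtain K'
    where [measurable]: "K' \<in> borel_measurable borel"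
      and K': "AE t in lborel. indicat_real {0..} t *\<^sub>R K t = K' t" by auto
  have [measurable]: "k' \<in> borel_measurable borel" using k' by (simp add: L1_loc_def)
  define g where "g = (\<lambda>z. case (max 0 (fst z), max 0 (snd z)) of (x, L) \<Rightarrow> f x L)"
  have g: "continuous_on UNIV g"
    unfolding g_def by (rule continuous_on_compose2[OF f_cont]) (auto intro!: continuous_intros)
  define y where "y = (\<lambda>t. g (k' t, K' t))"
  have [measurable]: "y \<in> borel_measurable borel"
    unfolding y_def by (rule borel_measurable_continuous_on[OF g]) measurable
  have y: "AE t in lborel. 0 \<le> t \<longrightarrow> y t = f (k t) (K t)"
    using k(2) k'(2) K'
  proof eventually_elim
    case (elim t)
    then show ?case using K(1)[of t] by (auto simp: y_def g_def max_absorb2)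
  qed
  have "L1_loc (\<lambda>t. \<bar>k' t\<bar>)" by (rule L1_loc_dominated[OF k'(1)]) auto
  then have "L1_loc (\<lambda>t. F + \<delta> * \<bar>k' t\<bar>)" by (intro L1_loc_add L1_loc_const L1_loc_cmult)
  moreover have "y \<in> borel_measurable borel" by measurable
  moreover have "AE t in lborel. 0 \<le> t \<longrightarrow> \<bar>y t\<bar> \<le> \<bar>F + \<delta> * \<bar>k' t\<bar>\<bar>"
    using y k(2) k'(2)
  proof eventually_elim
    case (elim t)
    show ?case
    proof
      assume t: "0 \<le> t"
      have "0 \<le> \<delta> * k t" using \<delta> elim t by simp
      then show "\<bar>y t\<bar> \<le> \<bar>F + \<delta> * \<bar>k' t\<bar>\<bar>"
        using output_bounds[of t "k t"] elim t F by auto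
    qed
  qed
  ultimately have "L1_loc y" by (rule L1_loc_dominated)
  with y that show thesis by blast
qed

text \<open>
  An absolutely continuous capital path is admissible as soon as the inequality between the measures
  holds for the densities.  The derivative is split as the difference of the measures with densities
  \<open>max 0 g\<close> and \<open>max 0 (- g)\<close>.
\<close>

lemma admissibleI:
  assumes g: "L1_loc g" and c: "L1_loc c" "AE t in lborel. 0 \<le> t \<longrightarrow> 0 \<le> c t"
    and k_nonneg: "AE t in lborel. 0 \<le> t \<longrightarrow> 0 \<le> k0 + primitive g t"
    and le: "AE t in lborel. 0 \<le> t \<longrightarrow> g t + c t \<le> f (k0 + primitive g t) (K t)"
  shows "(\<lambda>t. k0 + primitive g t, measure_of_density c) \<in> admissible f K k0"
proof -
  let ?k = "\<lambda>t. k0 + primitive g t"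
  let ?P = "measure_of_density (\<lambda>t. max 0 (g t))" and ?N = "measure_of_density (\<lambda>t. max 0 (- g t))"
  have [measurable]: "g \<in> borel_measurable borel" using g by (simp add: L1_loc_def)
  have p: "L1_loc (\<lambda>t. max 0 (g t))" and n: "L1_loc (\<lambda>t. max 0 (- g t))"
    by (rule L1_loc_dominated[OF g]; auto)+
  have k: "?k absolutely_integrable_on {0..T}" for T
    by (intro L1_loc_absolutely_integrable L1_loc_add L1_loc_const L1_loc_primitive g)
  have radon: "radon_halfline ?P" "radon_halfline ?N"
    using p n by (auto intro!: radon_measure_of_density)
  have PN: "measure ?P A - measure ?N A = (LBINT t:A. g t)" if "A \<in> sets borel" "A \<subseteq> {0..T}" for A T
  proof -
    have "measure ?P A - measure ?N A = (LBINT t:A. max 0 (g t)) - (LBINT t:A. max 0 (- g t))"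
      using that p n by (simp add: measure_measure_of_density[of _ A T])
    also have "\<dots> = (LBINT t:A. max 0 (g t) - max 0 (- g t))"
      using that p n by (intro set_integral_diff(2)[symmetric] L1_loc_set_integrable) auto
    also have "(\<lambda>t. max 0 (g t) - max 0 (- g t)) = g" by (auto simp: max_def)
    finally show ?thesis .
  qed
  have deriv: "has_deriv_measure ?k ?P ?N"
  proof -
    have "measure ?P {0..t} - measure ?N {0..t} = primitive g t" for t
      using PN[of "{0..t}" t] by (auto simp: primitive_def)
    then show ?thesis
      unfolding has_deriv_measure_iff[OF k radon] add_diff_eq[symmetric] using g by simp
  qed
  obtain y where y: "L1_loc y" "AE t in lborel. 0 \<le> t \<longrightarrow> y t = f (?k t) (K t)"
    using output_representative[OF k k_nonneg] by blast
  have "measure ?P A - measure ?N A + measure (measure_of_density c) A \<le> (LINT t:A|lebesgue. f (?k t) (K t))"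
    if A: "A \<in> sets borel" "A \<subseteq> {0..}" "bounded A" for A
  proof -
    obtain T where T: "A \<subseteq> {0..T}" using A(2,3) by (force simp: bounded_iff)
    have "measure ?P A - measure ?N A + measure (measure_of_density c) A = (LBINT t:A. g t) + (LBINT t:A. c t)"
      using PN[OF A(1) T] measure_measure_of_density[OF c A(1) T] by simp
    also have "\<dots> = (LBINT t:A. g t + c t)"
      using g c A T by (intro set_integral_add(2)[symmetric] L1_loc_set_integrable) auto
    also have "\<dots> \<le> (LBINT t:A. y t)"
      unfolding set_lebesgue_integral_def
    proof (rule integral_mono_AE)
      show "integrable lborel (\<lambda>t. indicat_real A t *\<^sub>R (g t + c t))" "integrable lborel (\<lambda>t. indicat_real A t *\<^sub>R y t)"
        using L1_loc_set_integrable[OF L1_loc_add[OF g c(1)] A(1) T] L1_loc_set_integrable[OF y(1) A(1) T]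
        by (auto simp: set_integrable_def)
      show "AE t in lborel. indicat_real A t *\<^sub>R (g t + c t) \<le> indicat_real A t *\<^sub>R y t"
        using le y(2) by eventually_elim (use A(2) in \<open>auto simp: indicator_def\<close>)
    qed
    also have "\<dots> = (LINT t:A|lebesgue. f (?k t) (K t))"
    proof (rule set_integral_lebesgue_representative[symmetric])
      show "AE t in lborel. t \<in> A \<longrightarrow> f (?k t) (K t) = y t"
        using y(2) by eventually_elim (use A(2) in auto)
    qed (use y A in \<open>auto simp: L1_loc_def\<close>)
    finally show ?thesis .
  qed
  moreover have "BV_loc ?k" unfolding BV_loc_def using k deriv by blast
  moreover have "AE t in lebesgue. 0 \<le> t \<longrightarrow> 0 \<le> ?k t" unfolding AE_completion_iff by (rule k_nonneg)
  ultimately show ?thesis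
    unfolding admissible_def using radon_measure_of_density[OF c] deriv g by auto
qed

text \<open>
  \<open>y\<close> is the output and \<open>W t\<close> is the output wasted up to time \<open>t\<close>.  Waste need not be absolutely
  continuous: capital may jump downwards.  The inequality between measures, tested on intervals, says
  that \<open>W\<close> is nonnegative and nondecreasing.
\<close>

lemma admissible_integral_form:
  assumes adm: "(k, measure_of_density c) \<in> admissible f K k0"
    and c: "L1_loc c" "AE t in lborel. 0 \<le> t \<longrightarrow> 0 \<le> c t"
  obtains y W where "L1_loc y" "AE t in lborel. 0 \<le> t \<longrightarrow> y t = f (k t) (K t)"
    "L1_loc W" "\<And>t. 0 \<le> t \<Longrightarrow> 0 \<le> W t" "\<And>s t. 0 \<le> s \<Longrightarrow> s \<le> t \<Longrightarrow> W s \<le> W t"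
    "AE t in lborel. 0 \<le> t \<longrightarrow> k t = k0 + primitive (\<lambda>s. y s - c s) t - W t"
proof -
  from adm obtain P N where
    k: "\<And>T. k absolutely_integrable_on {0..T}" and nonneg: "AE t in lborel. 0 \<le> t \<longrightarrow> 0 \<le> k t"
    and "k 0 = k0" and deriv: "has_deriv_measure k P N"
    and le: "\<And>A. \<lbrakk>A \<in> sets borel; A \<subseteq> {0..}; bounded A\<rbrakk> \<Longrightarrow>
        measure P A - measure N A + measure (measure_of_density c) A \<le> (LINT t:A|lebesgue. f (k t) (K t))"
    unfolding admissible_def BV_loc_def AE_completion_iff by auto
  have P: "radon_halfline P" and N: "radon_halfline N" using deriv by (auto simp: has_deriv_measure_def)
  obtain y where y: "L1_loc y" "AE t in lborel. 0 \<le> t \<longrightarrow> y t = f (k t) (K t)"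
    using output_representative[OF k nonneg] by blast
  define W where "W = (\<lambda>t. primitive (\<lambda>s. y s - c s) t - (measure P {0..t} - measure N {0..t}))"
  have yc: "L1_loc (\<lambda>s. y s - c s)" by (intro L1_loc_diff y c)
  have le': "measure P A - measure N A \<le> (LBINT t:A. y t - c t)"
    if A: "A \<in> sets borel" "A \<subseteq> {0..T}" for A T
  proof -
    have "bounded A" by (rule bounded_subset[OF bounded_closed_interval A(2)])
    then have "measure P A - measure N A + measure (measure_of_density c) A \<le> (LINT t:A|lebesgue. f (k t) (K t))"
      using A by (intro le) auto
    also have "\<dots> = (LBINT t:A. y t)"
    proof (rule set_integral_lebesgue_representative)
      show "AE t in lborel. t \<in> A \<longrightarrow> f (k t) (K t) = y t"
        using y(2) by eventually_elim (use A(2) in auto)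
    qed (use y A in \<open>auto simp: L1_loc_def\<close>)
    finally have "measure P A - measure N A \<le> (LBINT t:A. y t) - (LBINT t:A. c t)"
      using measure_measure_of_density[OF c A] by simp
    also have "\<dots> = (LBINT t:A. y t - c t)"
      using A y c by (intro set_integral_diff(2)[symmetric] L1_loc_set_integrable) auto
    finally show ?thesis .
  qed
  have mono: "W s \<le> W t" if st: "0 \<le> s" "s \<le> t" for s t
  proof -
    have split: "measure \<mu> {s<..t} = measure \<mu> {0..t} - measure \<mu> {0..s}" if "radon_halfline \<mu>" for \<mu>
    proof -
      have "{s<..t} = {0..t} - {0..s}" using st by auto
      then show ?thesis using that st
        by (simp add: radon_halfline_def measure_Diff less_top[symmetric])
    qed
    have "measure P {s<..t} - measure N {s<..t} \<le> (LBINT x:{s<..t}. y x - c x)"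
      using st by (intro le'[of _ t]) auto
    also have "(LBINT x:{s<..t}. y x - c x) = (LBINT x:{s..t}. y x - c x)"
      unfolding set_lebesgue_integral_def using yc AE_lborel_singleton[of s]
      by (intro integral_cong_AE) (auto simp: L1_loc_def indicator_def elim!: eventually_mono)
    finally show ?thesis
      unfolding W_def split[OF P] split[OF N] using primitive_diff_eq[OF yc st] by simp
  qed
  have "0 \<le> W t" for t
    using le'[of "{0..t}" t] by (simp add: W_def primitive_def)
  moreover have "AE t in lborel. 0 \<le> t \<longrightarrow> k t = k0 + primitive (\<lambda>s. y s - c s) t - W t"
    using deriv unfolding has_deriv_measure_iff[OF k P N] by (simp add: W_def \<open>k 0 = k0\<close> algebra_simps)
  moreover have "L1_loc W"
      unfolding W_def by (intro L1_loc_diff L1_loc_primitive yc L1_loc_measure_radon P N)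
  ultimately show thesis using y mono by (intro that[of y W])
qed

text \<open>
  Savings can be carried over time.  Let extra capital \<open>h\<close> be kept beside \<open>k\<close>.  As output drops by at
  most \<open>\<delta> h\<close>, the pair \<open>(k + h, c + e\<^bsup>-\<delta>t\<^esup> q)\<close> is admissible if \<open>h\<close> satisfies the linear equation
  \<open>dh = dW - (\<delta> h + e\<^bsup>-\<delta>t\<^esup> q) dt\<close>, in which the waste \<open>W\<close> is recovered.  Its solution is at least
  \<open>e\<^bsup>-\<delta>t\<^esup>\<close> times \<open>W(t)\<close> minus the integral of \<open>q\<close> over \<open>[0,t]\<close>, whence the condition on \<open>q\<close>: expressed
  in units of capital set aside at time \<open>0\<close>, no more may be consumed than was wasted or saved before.
\<close>

lemma deferral_admissible:
  assumes k: "\<And>T. k absolutely_integrable_on {0..T}" "AE t in lborel. 0 \<le> t \<longrightarrow> 0 \<le> k t"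
    and y: "L1_loc y" "AE t in lborel. 0 \<le> t \<longrightarrow> y t = f (k t) (K t)"
    and W: "L1_loc W" "\<And>t. 0 \<le> t \<Longrightarrow> 0 \<le> W t" "\<And>s t. 0 \<le> s \<Longrightarrow> s \<le> t \<Longrightarrow> W s \<le> W t"
    and k_eq: "AE t in lborel. 0 \<le> t \<longrightarrow> k t = k0 + primitive (\<lambda>s. y s - c s) t - W t"
    and c: "L1_loc c"
    and q: "L1_loc q" "AE t in lborel. 0 \<le> t \<longrightarrow> 0 \<le> c t + exp (- \<delta> * t) * q t"
    and qW: "\<And>t. 0 \<le> t \<Longrightarrow> primitive q t \<le> W t"
  shows "\<exists>k'. (k', measure_of_density (\<lambda>t. c t + exp (- \<delta> * t) * q t)) \<in> admissible f K k0"
proof -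
  define z where "z = (\<lambda>s. (\<delta> * exp (\<delta> * s)) * W s + q s)"
  define h where "h = (\<lambda>t. W t - exp (- \<delta> * t) * primitive z t)"
  have exp_mult: "L1_loc (\<lambda>s. exp (a * s) * u s)" "L1_loc (\<lambda>s. (b * exp (a * s)) * u s)" if "L1_loc u" for u a b
    by (intro L1_loc_mult_continuous that continuous_intros)+
  have z: "L1_loc z" unfolding z_def by (intro L1_loc_add exp_mult W q)
  have h: "L1_loc h" unfolding h_def by (intro L1_loc_diff exp_mult W L1_loc_primitive z)
  let ?p = "\<lambda>t. exp (- \<delta> * t) * q t"
  have p: "L1_loc ?p" by (intro exp_mult q)
  \<comment> \<open>The equation for \<open>h\<close> in integrated form, from the Leibniz rule for \<open>e\<^bsup>-\<delta>t\<^esup>\<close> times the integral of \<open>z\<close>.\<close>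
  have h_eq: "primitive (\<lambda>s. \<delta> * h s + ?p s) t = W t - h t" if t: "0 \<le> t" for t
  proof -
    have "exp (- \<delta> * t) * primitive z t =
        primitive (\<lambda>s. (1 + primitive (\<lambda>s. - \<delta> * exp (- \<delta> * s)) s) * z s + (0 + primitive z s) * (- \<delta> * exp (- \<delta> * s))) t"
      using primitive_product_rule[OF primitive_exp(2)[of 0 "- \<delta>"] z t, of 1 0] primitive_exp(1)[OF t, of "- \<delta>"] by simp
    also have "\<dots> = primitive (\<lambda>s. \<delta> * h s + ?p s) t"
    proof (rule primitive_cong)
      fix s :: real assume "0 \<le> s"
      have "exp (- \<delta> * s) * z s = \<delta> * W s * (exp (- \<delta> * s) * exp (\<delta> * s)) + ?p s"
        by (simp add: z_def algebra_simps)
      also have "exp (- \<delta> * s) * exp (\<delta> * s) = 1" by (simp flip: exp_add)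
      finally show "(1 + primitive (\<lambda>s. - \<delta> * exp (- \<delta> * s)) s) * z s + (0 + primitive z s) * (- \<delta> * exp (- \<delta> * s)) =
          \<delta> * h s + ?p s"
        unfolding primitive_exp(1)[OF \<open>0 \<le> s\<close>, of "- \<delta>", symmetric]
        by (simp add: h_def algebra_simps)
    qed
    finally show ?thesis by (simp add: h_def)
  qed
  \<comment> \<open>Here monotonicity of \<open>W\<close> enters: \<open>W s\<close> is replaced by \<open>W t\<close> under the integral.\<close>
  have h_nonneg: "0 \<le> h t" if t: "0 \<le> t" for t
  proof -
    have "primitive (\<lambda>s. (\<delta> * exp (\<delta> * s)) * W s) t \<le> primitive (\<lambda>s. W t * (\<delta> * exp (\<delta> * s))) t"
    proof (rule primitive_mono_AE)
      show "AE s in lborel. 0 \<le> s \<and> s \<le> t \<longrightarrow> (\<delta> * exp (\<delta> * s)) * W s \<le> W t * (\<delta> * exp (\<delta> * s))"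
        using W(3)[of _ t] \<delta> by (auto intro!: AE_I2 mult_left_mono simp: mult.commute)
    qed (intro exp_mult W L1_loc_cmult primitive_exp(2)[OF order_refl])+
    also have "\<dots> = W t * (exp (\<delta> * t) - 1)"
      unfolding primitive_cmult[of "W t" "\<lambda>s. \<delta> * exp (\<delta> * s)"]
      using primitive_exp(1)[OF t, of \<delta>] by simp
    finally have "primitive z t \<le> W t * exp (\<delta> * t)"
      unfolding z_def primitive_add[OF exp_mult(2)[OF W(1)] q(1)] using qW[OF t] by (simp add: algebra_simps)
    then have "exp (- \<delta> * t) * primitive z t \<le> exp (- \<delta> * t) * (W t * exp (\<delta> * t))"
      by (intro mult_left_mono) auto
    also have "\<dots> = W t * (exp (- \<delta> * t) * exp (\<delta> * t))" by simp
    also have "exp (- \<delta> * t) * exp (\<delta> * t) = 1" by (simp flip: exp_add)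
    finally show ?thesis by (simp add: h_def)
  qed
  let ?g = "\<lambda>t. (y t - c t) - (\<delta> * h t + ?p t)"
  have g: "L1_loc ?g" by (intro L1_loc_diff L1_loc_add L1_loc_cmult y c h p)
  have k': "AE t in lborel. 0 \<le> t \<longrightarrow> k0 + primitive ?g t = k t + h t"
    using k_eq
  proof eventually_elim
    case (elim t)
    show ?case
      using elim h_eq[of t] primitive_diff[OF L1_loc_diff[OF y(1) c] L1_loc_add[OF L1_loc_cmult[OF h] p], of \<delta> t]
      by simp
  qed
  have "(\<lambda>t. k0 + primitive ?g t, measure_of_density (\<lambda>t. c t + ?p t)) \<in> admissible f K k0"
  proof (rule admissibleI[OF g _ q(2)])
    show "L1_loc (\<lambda>t. c t + ?p t)" by (intro L1_loc_add c p)
    show "AE t in lborel. 0 \<le> t \<longrightarrow> 0 \<le> k0 + primitive ?g t"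
      using k' k(2) by eventually_elim (use h_nonneg in auto)
    show "AE t in lborel. 0 \<le> t \<longrightarrow> ?g t + (c t + ?p t) \<le> f (k0 + primitive ?g t) (K t)"
      using k' k(2) y(2)
    proof eventually_elim
      case (elim t)
      show ?case
      proof
        assume t: "0 \<le> t"
        then have "f (k t) (K t) - \<delta> * h t \<le> f (k t + h t) (K t)"
          using elim h_nonneg[OF t] K by (intro f_lower) auto
        with elim t show "?g t + (c t + ?p t) \<le> f (k0 + primitive ?g t) (K t)" by simp
      qed
    qed
  qed
  then show ?thesis by blast
qed

end

section \<open>Optimal pairs\<close>

locale optimum = environment +
  fixes k c :: "real \<Rightarrow> real"
  assumes c: "L1_loc c" and c_nonneg: "AE t in lborel. 0 \<le> t \<longrightarrow> 0 \<le> c t"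
    and optimal: "optimal_pair f U r K k0 k (measure_of_density c)"

begin

lemma admissible_optimum: "(k, measure_of_density c) \<in> admissible f K k0"
  using optimal by (simp add: optimal_pair_def)

lemma k_absolutely_integrable: "k absolutely_integrable_on {0..T}"
  and k_nonneg: "AE t in lborel. 0 \<le> t \<longrightarrow> 0 \<le> k t"
  using admissible_optimum unfolding admissible_def BV_loc_def AE_completion_iff by auto

lemma primitive_consumption_mono:
  assumes "0 \<le> u" "u \<le> v"
  shows "primitive c u \<le> primitive c v"
proof -
  have "AE s in lborel. u < s \<and> s \<le> v \<longrightarrow> 0 \<le> c s"
    using c_nonneg by eventually_elim (use assms in auto)
  from primitive_increment_ge[OF c assms this] show ?thesis by simp
qed

text \<open>
  Consumption is paid from initial capital and output.  The estimate holds at almost every time because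
  capital is nonnegative, and then at every time because cumulative consumption is monotone.
\<close>

lemma primitive_consumption_le:
  assumes t: "0 \<le> t"
  shows "primitive c t \<le> k0 + F * t"
proof (rule field_le_epsilon)
  fix e :: real assume "0 < e"
  obtain y W where y: "L1_loc y" "AE t in lborel. 0 \<le> t \<longrightarrow> y t = f (k t) (K t)"
    and W: "L1_loc W" "\<And>t. 0 \<le> t \<Longrightarrow> 0 \<le> W t" "\<And>s t. 0 \<le> s \<Longrightarrow> s \<le> t \<Longrightarrow> W s \<le> W t"
    and k: "AE t in lborel. 0 \<le> t \<longrightarrow> k t = k0 + primitive (\<lambda>s. y s - c s) t - W t"
    using admissible_integral_form[OF admissible_optimum c c_nonneg] by blast
  have yF: "AE t in lborel. 0 \<le> t \<longrightarrow> y t \<le> F"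
    using y(2) k_nonneg by eventually_elim (use output_bounds(2) in auto)
  have ae: "AE t in lborel. 0 \<le> t \<longrightarrow> primitive c t \<le> k0 + F * t"
    using k k_nonneg
  proof eventually_elim
    case (elim t)
    show ?case
    proof
      assume t: "0 \<le> t"
      have "primitive y t - primitive y 0 \<le> F * (t - 0)"
        using yF t by (intro primitive_increment_le[OF y(1)]) (auto elim: eventually_mono)
      then show "primitive c t \<le> k0 + F * t"
        using elim t W(2)[OF t] y(1) by (simp add: primitive_diff[OF y(1) c])
    qed
  qed
  \<comment> \<open>A good time so close to \<open>t\<close> that \<open>F (s - t) \<le> e\<close>.\<close>
  obtain s where s: "t < s" "s < t + e / (F + 1)" "primitive c s \<le> k0 + F * s"
    using AE_halfline_dense[OF ae t, of "t + e / (F + 1)"] \<open>0 < e\<close> F by auto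
  have "primitive c t \<le> primitive c s" using s t by (intro primitive_consumption_mono) auto
  moreover have "F * (s - t) \<le> (F + 1) * (e / (F + 1))"
    using s F by (intro mult_mono) auto
  then have "F * (s - t) \<le> e" using F by simp
  then have "F * s \<le> F * t + e" by (simp add: algebra_simps)
  ultimately show "primitive c t \<le> k0 + F * t + e" using s(3) by simp
qed

lemma discounted_utility_integrable:
  "integrable lborel (\<lambda>t. indicator {0..} t * (exp (- r * t) * U (max 0 (c t))))"
  and discounted_utility_le: "(LBINT t. indicator {0..} t * (exp (- r * t) * U (max 0 (c t)))) \<le> J_max"
proof -
  have [measurable]: "c \<in> borel_measurable borel" using c by (simp add: L1_loc_def)
  note utility_measurable[OF utility, measurable]
  let ?h = "\<lambda>t. indicator {0..} t * (exp (- r * t) * U (max 0 (c t)))"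
  have 0: "0 \<le> ?h t" for t using utility_nonneg[OF utility, of "max 0 (c t)"] by simp
  have le: "(\<integral>\<^sup>+t. ennreal (?h t) \<partial>lborel) \<le> ennreal J_max"
    by (rule discounted_utility_bound[OF c c_nonneg primitive_consumption_le])
  show i: "integrable lborel ?h"
  proof (rule integrableI_nonneg)
    show "(\<integral>\<^sup>+t. ennreal (?h t) \<partial>lborel) < \<infinity>" using le by (rule le_less_trans) simp
  qed (use 0 in auto)
  have "0 \<le> J_max" using utility_nonneg[OF utility, of 1] r k0 F by (simp add: J_max_def)
  then show "(LBINT t. ?h t) \<le> J_max"
    using le nn_integral_eq_integral[OF i] 0 by simp
qed

text \<open>
  The form in which optimality is used: \<open>G\<close> is a lower bound for the change of discounted utility caused
  by passing to \<open>c'\<close>.  Finiteness of the value is essential, since the two values are subtracted.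
\<close>

lemma no_profitable_deviation:
  assumes adm: "(k', measure_of_density c') \<in> admissible f K k0"
    and c': "L1_loc c'" "AE t in lborel. 0 \<le> t \<longrightarrow> 0 \<le> c' t"
    and G: "integrable lborel (\<lambda>t. indicator {0..} t * G t)"
    and gain: "AE t in lborel. 0 \<le> t \<longrightarrow> exp (- r * t) * U (c t) + G t \<le> exp (- r * t) * U (c' t)"
  shows "(LBINT t. indicator {0..} t * G t) \<le> 0"
proof -
  have [measurable]: "c' \<in> borel_measurable borel" using c' by (simp add: L1_loc_def)
  note utility_measurable[OF utility, measurable]
  let ?h = "\<lambda>c t. indicator {0..} t * (exp (- r * t) * U (max 0 (c t)))"
  have 0: "0 \<le> ?h c t" for c t using utility_nonneg[OF utility, of "max 0 (c t)"] by simp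
  have "J_inf U r (measure_of_density c') \<le> J_inf U r (measure_of_density c)"
    using optimal adm by (auto simp: optimal_pair_def)
  then have le: "(\<integral>\<^sup>+t. ennreal (?h c' t) \<partial>lborel) \<le> (\<integral>\<^sup>+t. ennreal (?h c t) \<partial>lborel)"
    unfolding J_inf_measure_of_density[OF c c_nonneg] J_inf_measure_of_density[OF c'] .
  also have "\<dots> = ennreal (LBINT t. ?h c t)"
    by (intro nn_integral_eq_integral discounted_utility_integrable AE_I2 0)
  finally have le': "(\<integral>\<^sup>+t. ennreal (?h c' t) \<partial>lborel) \<le> ennreal (LBINT t. ?h c t)" .
  have i': "integrable lborel (?h c')"
  proof (rule integrableI_nonneg)
    show "(\<integral>\<^sup>+t. ennreal (?h c' t) \<partial>lborel) < \<infinity>" using le' by (rule le_less_trans) simp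
  qed (use 0 in auto)
  have "0 \<le> (LBINT t. ?h c t)" by (intro integral_nonneg_AE AE_I2 0)
  then have "(LBINT t. ?h c' t) \<le> (LBINT t. ?h c t)"
    using le' nn_integral_eq_integral[OF i'] 0 by simp
  moreover have "(LBINT t. ?h c t + indicator {0..} t * G t) \<le> (LBINT t. ?h c' t)"
  proof (rule integral_mono_AE[OF Bochner_Integration.integrable_add[OF discounted_utility_integrable G] i'])
    show "AE t in lborel. ?h c t + indicator {0..} t * G t \<le> ?h c' t"
      using gain c_nonneg c'(2) by eventually_elim (auto simp: indicator_def)
  qed
  then have "(LBINT t. ?h c t) + (LBINT t. indicator {0..} t * G t) \<le> (LBINT t. ?h c' t)"
    using discounted_utility_integrable G by simp
  ultimately show ?thesis by simp
qed

text \<open>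
  If \<open>W a > 0\<close>, the wasted amount could be consumed during \<open>[a,a+1]\<close>.  This raises the
  value strictly, because \<open>c\<close> stays bounded on a subset of \<open>[a,a+1]\<close> of positive measure.
\<close>

lemma no_waste:
  obtains y where "L1_loc y" "AE t in lborel. 0 \<le> t \<longrightarrow> y t = f (k t) (K t)"
    "AE t in lborel. 0 \<le> t \<longrightarrow> k t = k0 + primitive (\<lambda>s. y s - c s) t"
proof -
  obtain y W where y: "L1_loc y" "AE t in lborel. 0 \<le> t \<longrightarrow> y t = f (k t) (K t)"
    and W: "L1_loc W" "\<And>t. 0 \<le> t \<Longrightarrow> 0 \<le> W t" "\<And>s t. 0 \<le> s \<Longrightarrow> s \<le> t \<Longrightarrow> W s \<le> W t"
    and k: "AE t in lborel. 0 \<le> t \<longrightarrow> k t = k0 + primitive (\<lambda>s. y s - c s) t - W t"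
    using admissible_integral_form[OF admissible_optimum c c_nonneg] by blast
  have [measurable]: "c \<in> borel_measurable borel" using c by (simp add: L1_loc_def)
  have "W a = 0" if a: "0 \<le> a" for a
  proof (rule ccontr)
    assume "W a \<noteq> 0"
    with W(2)[OF a] have m: "0 < W a" by simp
    let ?q = "\<lambda>t. W a * indicat_real {a..a+1} t"
    let ?c = "\<lambda>t. c t + exp (- \<delta> * t) * ?q t"
    have q: "L1_loc ?q" by (intro L1_loc_cmult primitive_indicator) auto
    have qc: "AE t in lborel. 0 \<le> t \<longrightarrow> 0 \<le> ?c t"
      using c_nonneg by eventually_elim (use m in \<open>auto simp: indicator_def\<close>)
    have qW: "primitive ?q t \<le> W t" if t: "0 \<le> t" for t
    proof (cases "a \<le> t")
      case True
      have "measure lborel ({a..a+1} \<inter> {0..t}) \<le> measure lborel {a..a+1}"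
        by (intro measure_mono_fmeasurable) (auto simp: fmeasurable_def)
      then have "W a * measure lborel ({a..a+1} \<inter> {0..t}) \<le> W a * 1"
        using m by (intro mult_left_mono) auto
      also have "\<dots> \<le> W t" using W(3)[OF a True] by simp
      finally show ?thesis by (simp add: primitive_cmult primitive_indicator)
    next
      case False
      then have "{a..a+1} \<inter> {0..t} = {}" by auto
      then show ?thesis using W(2)[OF t] by (simp add: primitive_cmult primitive_indicator)
    qed
    obtain k' where adm: "(k', measure_of_density ?c) \<in> admissible f K k0"
      using deferral_admissible[OF k_absolutely_integrable k_nonneg y W k c q qc qW] by blast
    have c': "L1_loc ?c" by (intro L1_loc_add c L1_loc_mult_continuous q continuous_intros)
    \<comment> \<open>Mean consumption over \<open>[a,a+1]\<close> is less than \<open>b\<close>.\<close>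
    define b where "b = k0 + F * (a + 1) + 1"
    have b: "0 < b" using k0 F a by (simp add: b_def add_pos_nonneg)
    let ?B = "{t \<in> {a<..a+1}. c t \<le> b}"
    have B: "?B \<in> sets borel" "?B \<subseteq> {0..a+1}" using a by auto
    have B_pos: "0 < measure lborel ?B"
      using primitive_consumption_le[of "a + 1"] primitive_consumption_mono[of 0 a] a c
      by (intro small_values_on_interval[OF c a, of _ "k0 + F * (a + 1)"]) (auto simp: b_def)
    define e where "e = exp (- \<delta> * (a + 1)) * W a"
    have e: "0 < e" using m by (simp add: e_def)
    define g where "g = exp (- r * (a + 1)) * (U (b + e) - U b)"
    have g: "0 < g" using utility_less[OF utility, of b "b + e"] b e by (simp add: g_def)
    have G0: "(\<lambda>t. indicat_real {0..} t * (g * indicat_real ?B t)) = (\<lambda>t. g * indicat_real ?B t)"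
      using a by (auto simp: indicator_def)
    have "(LBINT t. indicator {0..} t * (g * indicat_real ?B t)) \<le> 0"
    proof (rule no_profitable_deviation[OF adm c' qc])
      show "integrable lborel (\<lambda>t. indicat_real {0..} t * (g * indicat_real ?B t))"
        unfolding G0 by (intro integrable_mult_right integrable_indicator_subset_Icc[OF B])
      show "AE t in lborel. 0 \<le> t \<longrightarrow> exp (- r * t) * U (c t) + g * indicat_real ?B t \<le> exp (- r * t) * U (?c t)"
        using c_nonneg
      proof eventually_elim
        case (elim t)
        show ?case
        proof
          assume t: "0 \<le> t"
          with elim have ct: "0 \<le> c t" by simp
          show "exp (- r * t) * U (c t) + g * indicat_real ?B t \<le> exp (- r * t) * U (?c t)"
          proof (cases "t \<in> ?B")
            case True
            then have "\<delta> * t \<le> \<delta> * (a + 1)" using \<delta> by (intro mult_left_mono) auto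
            then have "e \<le> exp (- \<delta> * t) * ?q t"
              using True m by (simp add: e_def)
            then have "U (c t + e) \<le> U (?c t)" using ct e by (intro utility_mono[OF utility]) auto
            moreover have "U (b + e) - U b \<le> U (c t + e) - U (c t)"
              using True ct e by (intro utility_increment_antimono[OF utility]) auto
            ultimately have *: "U (b + e) - U b \<le> U (?c t) - U (c t)" by simp
            have "r * t \<le> r * (a + 1)" using True r by (intro mult_left_mono) auto
            then have "g \<le> exp (- r * t) * (U (b + e) - U b)"
              unfolding g_def using utility_less[OF utility, of b "b + e"] b e by (intro mult_right_mono) auto
            also have "\<dots> \<le> exp (- r * t) * (U (?c t) - U (c t))" using * by (intro mult_left_mono) auto
            finally show ?thesis using True by (simp add: algebra_simps)
          next
            case False
            have "U (c t) \<le> U (?c t)" using ct m by (intro utility_mono[OF utility]) (auto simp: indicator_def)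
            with False show ?thesis by simp
          qed
        qed
      qed
    qed
    then have "g * measure lborel ?B \<le> 0" unfolding G0 by simp
    with g B_pos show False by (simp add: mult_le_0_iff)
  qed
  then have "AE t in lborel. 0 \<le> t \<longrightarrow> k t = k0 + primitive (\<lambda>s. y s - c s) t"
    using k by (auto elim: eventually_mono)
  with y that show thesis by blast
qed

text \<open>
  The Euler inequality for saving on \<open>A\<close> and consuming later on \<open>B\<close>, with the discount and the
  depreciation over the whole horizon \<open>S\<close> as a crude factor.  The deviation lowers consumption on \<open>A\<close> by
  \<open>\<epsilon> e\<^bsup>-\<delta>t\<^esup>\<close> and raises it on \<open>B\<close> by \<open>\<gamma> e\<^bsup>-\<delta>t\<^esup>\<close>, where \<open>\<epsilon> |A| = \<gamma> |B|\<close> balances the accounts.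
\<close>

lemma deferral_inequality:
  assumes A: "A \<in> sets borel" "A \<subseteq> {0..a}" "0 < measure lborel A"
    and B: "B \<in> sets borel" "B \<subseteq> {a<..S}" "0 < measure lborel B"
    and \<alpha>: "0 < \<alpha>" "\<And>t. t \<in> A \<Longrightarrow> \<alpha> \<le> c t" and \<beta>: "0 < \<beta>" "\<And>t. t \<in> B \<Longrightarrow> c t \<le> \<beta>"
    and aS: "0 \<le> a" "a \<le> S"
  shows "exp (- (r + \<delta>) * S) * right_deriv U (2 * \<beta>) \<le> right_deriv U (\<alpha> / 2)"
proof -
  obtain y where y: "L1_loc y" "AE t in lborel. 0 \<le> t \<longrightarrow> y t = f (k t) (K t)"
    and k: "AE t in lborel. 0 \<le> t \<longrightarrow> k t = k0 + primitive (\<lambda>s. y s - c s) t"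
    by (rule no_waste)
  define mA mB where "mA = measure lborel A" and "mB = measure lborel B"
  have mA: "0 < mA" and mB: "0 < mB" using A B by (auto simp: mA_def mB_def)
  \<comment> \<open>The minimum keeps \<open>\<epsilon> \<le> \<alpha> / 2\<close> and \<open>\<gamma> \<le> \<beta>\<close>, the ranges in which the marginal utility estimates hold.\<close>
  define \<epsilon> where "\<epsilon> = min (\<alpha> / 2) (\<beta> * mB / mA)"
  define \<gamma> where "\<gamma> = \<epsilon> * mA / mB"
  have \<epsilon>: "0 < \<epsilon>" "\<epsilon> \<le> \<alpha> / 2" using \<alpha>(1) \<beta>(1) mA mB unfolding \<epsilon>_def by (simp, intro min.cobounded1)
  have \<gamma>: "0 < \<gamma>" "\<gamma> * mB = \<epsilon> * mA" using \<epsilon> mA mB by (auto simp: \<gamma>_def)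
  have "\<epsilon> \<le> \<beta> * mB / mA" by (simp add: \<epsilon>_def)
  then have "\<gamma> \<le> \<beta>" using mA mB by (simp add: \<gamma>_def field_simps)
  have dA: "t \<notin> A" if "t \<in> B" for t using that A(2) B(2) by force
  let ?q = "\<lambda>t. \<gamma> * indicat_real B t - \<epsilon> * indicat_real A t"
  let ?c = "\<lambda>t. c t + exp (- \<delta> * t) * ?q t"
  have q: "L1_loc ?q" by (intro L1_loc_diff L1_loc_cmult primitive_indicator A B)
  have exp_le: "exp (- \<delta> * t) \<le> 1" "exp (- r * t) \<le> 1" if "0 \<le> t" for t
    using that \<delta> r by auto
  have qc: "AE t in lborel. 0 \<le> t \<longrightarrow> 0 \<le> ?c t"
    using c_nonneg
  proof eventually_elim
    case (elim t)
    show ?case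
    proof
      assume t: "0 \<le> t"
      consider "t \<in> A" "t \<notin> B" | "t \<in> B" "t \<notin> A" | "t \<notin> A" "t \<notin> B" using dA by blast
      then show "0 \<le> ?c t"
      proof cases
        case 1
        have "exp (- \<delta> * t) * \<epsilon> \<le> 1 * \<epsilon>" using exp_le[OF t] \<epsilon> by (intro mult_right_mono) auto
        with \<alpha>(2)[OF 1(1)] \<epsilon> \<alpha>(1) have "exp (- \<delta> * t) * \<epsilon> \<le> c t" by linarith
        with 1 show ?thesis by simp
      qed (use elim t \<gamma> in auto)
    qed
  qed
  have qW: "primitive ?q t \<le> 0" if t: "0 \<le> t" for t
  proof -
    have eq: "primitive ?q t = \<gamma> * measure lborel (B \<inter> {0..t}) - \<epsilon> * measure lborel (A \<inter> {0..t})"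
      using A B by (subst primitive_diff) (auto intro!: L1_loc_cmult simp: primitive_cmult primitive_indicator)
    show ?thesis
    proof (cases "t \<le> a")
      case True
      then have "B \<inter> {0..t} = {}" using B(2) by force
      then show ?thesis unfolding eq using \<epsilon> by simp
    next
      case False
      then have "A \<inter> {0..t} = A" using A(2) by force
      moreover have "measure lborel (B \<inter> {0..t}) \<le> mB"
        unfolding mB_def
      proof (rule measure_mono_fmeasurable)
        have "integrable lborel (indicat_real B)" using B aS by (intro integrable_indicator_subset_Icc[of B a S]) auto
        then show "B \<in> fmeasurable lborel" by (simp add: fmeasurable_def integrable_indicator_iff B)
      qed (use B in auto)
      then have "\<gamma> * measure lborel (B \<inter> {0..t}) \<le> \<gamma> * mB" using \<gamma> by (intro mult_left_mono) auto
      ultimately show ?thesis unfolding eq using \<gamma>(2) by (simp add: mA_def)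
    qed
  qed
  have W0: "AE t in lborel. 0 \<le> t \<longrightarrow> k t = k0 + primitive (\<lambda>s. y s - c s) t - 0" using k by simp
  obtain k' where adm: "(k', measure_of_density ?c) \<in> admissible f K k0"
    using deferral_admissible[OF k_absolutely_integrable k_nonneg y L1_loc_const order_refl order_refl W0 c q qc qW] by blast
  have c': "L1_loc ?c" by (intro L1_loc_add c L1_loc_mult_continuous q continuous_intros)
  define gain where "gain = exp (- (r + \<delta>) * S) * right_deriv U (2 * \<beta>)"
  define loss where "loss = right_deriv U (\<alpha> / 2)"
  have loss: "0 < loss" using right_deriv_utility_pos[OF utility, of "\<alpha> / 2"] \<alpha>(1) by (simp add: loss_def)
  have D: "0 < right_deriv U (2 * \<beta>)" using right_deriv_utility_pos[OF utility, of "2 * \<beta>"] \<beta>(1) by simp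
  let ?G = "\<lambda>t. (\<gamma> * gain) * indicat_real B t - (\<epsilon> * loss) * indicat_real A t"
  have G0: "(\<lambda>t. indicat_real {0..} t * ?G t) = ?G"
    using A(2) B(2) aS by (auto simp: indicator_def fun_eq_iff)
  have intA: "integrable lborel (indicat_real A)" and intB: "integrable lborel (indicat_real B)"
    using A B aS by (auto intro!: integrable_indicator_subset_Icc[of A 0 a] integrable_indicator_subset_Icc[of B a S])
  have "(LBINT t. indicat_real {0..} t * ?G t) \<le> 0"
  proof (rule no_profitable_deviation[OF adm c' qc])
    show "integrable lborel (\<lambda>t. indicat_real {0..} t * ?G t)"
      unfolding G0 using intA intB by (intro Bochner_Integration.integrable_diff integrable_mult_right)
    show "AE t in lborel. 0 \<le> t \<longrightarrow> exp (- r * t) * U (c t) + ?G t \<le> exp (- r * t) * U (?c t)"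
      using c_nonneg
    proof eventually_elim
      case (elim t)
      show ?case
      proof
        assume t: "0 \<le> t"
        with elim have ct: "0 \<le> c t" by simp
        consider "t \<in> A" "t \<notin> B" | "t \<in> B" "t \<notin> A" | "t \<notin> A" "t \<notin> B" using dA by blast
        then show "exp (- r * t) * U (c t) + ?G t \<le> exp (- r * t) * U (?c t)"
        proof cases
          case 1
          let ?h = "exp (- \<delta> * t) * \<epsilon>"
          have h: "0 \<le> ?h" "?h \<le> 1 * \<epsilon>" using exp_le[OF t] \<epsilon> by (auto intro!: mult_right_mono)
          have "?h \<le> \<alpha> / 2" using h(2) \<epsilon>(2) by linarith
          then have "U (c t) - U (c t - ?h) \<le> ?h * loss"
            unfolding loss_def by (intro utility_loss[OF utility] \<alpha>(1) \<alpha>(2)[OF 1(1)] h(1))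
          then have "exp (- r * t) * (U (c t) - U (c t - ?h)) \<le> 1 * (?h * loss)"
            using exp_le[OF t] h loss
            by (intro order_trans[OF mult_left_mono mult_right_mono]) auto
          also have "\<dots> \<le> \<epsilon> * loss" using h loss by (simp add: mult_right_mono)
          finally show ?thesis using 1 by (simp add: algebra_simps)
        next
          case 2
          let ?h = "exp (- \<delta> * t) * \<gamma>"
          have h: "0 \<le> ?h" "?h \<le> 1 * \<gamma>" using exp_le[OF t] \<gamma> by (auto intro!: mult_right_mono)
          have "t \<le> S" using 2 B(2) by auto
          then have "(r + \<delta>) * t \<le> (r + \<delta>) * S" using r \<delta> by (intro mult_left_mono) auto
          then have "exp (- (r + \<delta>) * S) \<le> exp (- (r + \<delta>) * t)"
            by (simp only: exp_le_cancel_iff mult_minus_left neg_le_iff_le)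
          also have "\<dots> = exp (- r * t) * exp (- \<delta> * t)" by (simp add: algebra_simps flip: exp_add)
          finally have "exp (- (r + \<delta>) * S) * (\<gamma> * right_deriv U (2 * \<beta>)) \<le>
              (exp (- r * t) * exp (- \<delta> * t)) * (\<gamma> * right_deriv U (2 * \<beta>))"
            using \<gamma> D by (intro mult_right_mono) auto
          also have "\<dots> = exp (- r * t) * (?h * right_deriv U (2 * \<beta>))" by simp
          also have "\<dots> \<le> exp (- r * t) * (U (c t + ?h) - U (c t))"
          proof (intro mult_left_mono utility_gain[OF utility])
            show "?h \<le> \<beta>" using h(2) \<open>\<gamma> \<le> \<beta>\<close> by linarith
          qed (use ct \<beta>(1) \<beta>(2)[OF 2(1)] h(1) in auto)
          finally show ?thesis using 2 by (simp add: gain_def algebra_simps)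
        qed simp
      qed
    qed
  qed
  also have "(LBINT t. indicat_real {0..} t * ?G t) = \<gamma> * gain * mB - \<epsilon> * loss * mA"
    unfolding G0 using intA intB A B by (simp add: mA_def mB_def)
  finally have "(\<gamma> * mB) * gain \<le> (\<epsilon> * mA) * loss" by (simp add: mult_ac)
  then have "(\<epsilon> * mA) * gain \<le> (\<epsilon> * mA) * loss" unfolding \<gamma>(2) .
  moreover have "0 < \<epsilon> * mA" using \<epsilon> mA by simp
  ultimately have "gain \<le> loss" by (simp only: mult_le_cancel_left_pos)
  then show ?thesis by (simp only: gain_def loss_def)
qed

text \<open>
  The contrapositive of the Euler inequality: if consumption is small on average after time \<open>a\<close>, then it
  was small at almost all times before \<open>a\<close>, for otherwise saving earlier would have paid off.
\<close>

lemma consumption_small_before: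
  assumes ab: "0 \<le> a" "a < b" "b \<le> S"
    and le: "primitive c b - primitive c a \<le> \<eta> * (b - a)" "\<eta> < \<beta>" "0 < \<beta>"
    and \<alpha>: "0 < \<alpha>" "right_deriv U (\<alpha> / 2) < exp (- (r + \<delta>) * S) * right_deriv U (2 * \<beta>)"
  shows "AE t in lborel. 0 \<le> t \<and> t \<le> a \<longrightarrow> c t < \<alpha>"
proof -
  have [measurable]: "c \<in> borel_measurable borel" using c by (simp add: L1_loc_def)
  let ?A = "{t \<in> {0..a}. \<alpha> \<le> c t}" and ?B = "{t \<in> {a<..b}. c t \<le> \<beta>}"
  have B: "0 < measure lborel ?B" by (rule small_values_on_interval[OF c ab(1,2) le(1,2)])
  have "\<not> 0 < measure lborel ?A"
  proof
    assume "0 < measure lborel ?A"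
    then have "exp (- (r + \<delta>) * S) * right_deriv U (2 * \<beta>) \<le> right_deriv U (\<alpha> / 2)"
      using ab le(3) \<alpha>(1) B by (intro deferral_inequality[of ?A a ?B S]) auto
    with \<alpha>(2) show False by simp
  qed
  then have "AE t in lborel. t \<notin> ?A" by (intro AE_notin_of_measure_zero[of _ 0 a]) auto
  then show ?thesis by eventually_elim auto
qed

section \<open>Bounds on capital and consumption\<close>

text \<open>
  The interval \<open>[T,T+1]\<close> has unit length, so the mean consumption over it is at most \<open>k0 + F (T+1)\<close>, the
  bound for the total consumption up to \<open>T + 1\<close>.
\<close>

lemma consumption_less:
  assumes T: "0 < T" and \<alpha>: "0 < \<alpha>"
    "right_deriv U (\<alpha> / 2) < exp (- (r + \<delta>) * (T + 1)) * right_deriv U (2 * (k0 + F * (T + 1) + 1))"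
  shows "AE t in lborel. 0 \<le> t \<and> t \<le> T \<longrightarrow> c t < \<alpha>"
proof (rule consumption_small_before[where b="T + 1" and S="T + 1"])
  show "primitive c (T + 1) - primitive c T \<le> (k0 + F * (T + 1)) * (T + 1 - T)"
    using primitive_consumption_le[of "T + 1"] primitive_consumption_mono[of 0 T] T c by simp
  show "0 < k0 + F * (T + 1) + 1" using k0 F T by (simp add: add_pos_nonneg)
qed (use T \<alpha> in auto)

text \<open>
  If the capital were below \<open>\<kappa>\<close> at time \<open>t\<close>, it would stay below \<open>x0\<close> until \<open>t + s\<close>, output would be
  small there, and so would be mean consumption.  Then consumption was below \<open>\<alpha>\<close> on all of \<open>[0,t]\<close>.  But as
  output is nonnegative at low capital, such a modest plan cannot reduce the capital
  from \<open>min k0 k1\<close> to less than half of it within the time \<open>T\<close>.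
\<close>

lemma capital_bounded_below:
  assumes T: "0 < T" and \<alpha>: "0 < \<alpha>" "\<alpha> * T \<le> min k0 k1 / 2"
    and \<beta>: "0 < \<beta>" "right_deriv U (\<alpha> / 2) < exp (- (r + \<delta>) * (T + 1)) * right_deriv U (2 * \<beta>)"
    and x0: "0 < x0" "\<And>L x. \<lbrakk>L \<in> I; L \<le> M; 0 \<le> x; x \<le> x0\<rbrakk> \<Longrightarrow> f x L \<le> \<beta> / 4"
    and s: "0 < s" "s \<le> 1" "F * s \<le> x0 / 2"
    and \<kappa>: "\<kappa> \<le> min k0 k1 / 2" "\<kappa> \<le> x0 / 2" "\<kappa> \<le> s * \<beta> / 4"
    and y: "L1_loc y" "AE t in lborel. 0 \<le> t \<longrightarrow> y t = f (k t) (K t)"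
    and k: "AE t in lborel. 0 \<le> t \<longrightarrow> k t = k0 + primitive (\<lambda>s. y s - c s) t"
    and t: "0 \<le> t" "t \<le> T"
  shows "\<kappa> \<le> k0 + primitive (\<lambda>s. y s - c s) t"
proof (rule ccontr)
  define kc where "kc = (\<lambda>t. k0 + primitive (\<lambda>s. y s - c s) t)"
  define m where "m = min k0 k1"
  have m: "m \<le> k0" "m \<le> k1" "\<alpha> * T \<le> m / 2" "\<kappa> \<le> m / 2" using \<alpha> \<kappa> by (auto simp: m_def)
  assume "\<not> \<kappa> \<le> k0 + primitive (\<lambda>s. y s - c s) t"
  then have less: "kc t < \<kappa>" by (simp add: kc_def)
  have yc: "L1_loc (\<lambda>s. y s - c s)" by (intro L1_loc_diff y c)
  have cont: "continuous_on {0..} kc"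
    unfolding kc_def by (intro continuous_intros continuous_on_primitive yc)
  have k_eq: "AE t in lborel. 0 \<le> t \<longrightarrow> k t = kc t" using k by (simp add: kc_def)
  have "AE t in lborel. 0 \<le> t \<longrightarrow> 0 \<le> kc t" using k_eq k_nonneg by eventually_elim auto
  then have kc_nonneg: "0 \<le> kc t" if "0 \<le> t" for t using continuous_AE_nonneg[OF cont _ that] by blast
  have y_eq: "AE t in lborel. 0 \<le> t \<longrightarrow> y t = f (kc t) (K t)" using y(2) k_eq by eventually_elim auto
  have yF: "AE t in lborel. 0 \<le> t \<longrightarrow> y t \<le> F"
    using y_eq by eventually_elim (use output_bounds(2) kc_nonneg in auto)
  have kc_diff: "kc v - kc u = (primitive y v - primitive y u) - (primitive c v - primitive c u)" for u v
    by (simp add: kc_def primitive_diff[OF y(1) c])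
  \<comment> \<open>Capital grows at the rate \<open>F\<close> at most.\<close>
  have kc_near: "kc v \<le> x0" if "t \<le> v" "v \<le> t + s" for v
  proof -
    have "primitive y v - primitive y t \<le> F * (v - t)"
      using yF t that by (intro primitive_increment_le[OF y(1)]) (auto elim: eventually_mono)
    also have "\<dots> \<le> F * s" using F that by (intro mult_left_mono) auto
    finally show ?thesis using kc_diff[of v t] primitive_consumption_mono[of t v] that t less \<kappa>(2) s(3) by simp
  qed
  have "primitive y (t + s) - primitive y t \<le> \<beta> / 4 * (t + s - t)"
  proof (rule primitive_increment_le[OF y(1)])
    show "AE v in lborel. t < v \<and> v \<le> t + s \<longrightarrow> y v \<le> \<beta> / 4"
      using y_eq
    proof eventually_elim
      case (elim v)
      show ?case
        using elim t x0(2)[of "K v" "kc v"] K[of v] kc_nonneg[of v] kc_near[of v] by auto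
    qed
  qed (use t s in auto)
  then have "primitive c (t + s) - primitive c t \<le> \<kappa> + \<beta> / 4 * s"
    using kc_diff[of "t + s" t] kc_nonneg[of "t + s"] less t s by simp
  also have "\<dots> \<le> \<beta> / 2 * (t + s - t)" using \<kappa>(3) by (simp add: mult.commute)
  finally have "AE v in lborel. 0 \<le> v \<and> v \<le> t \<longrightarrow> c v < \<alpha>"
    using t s \<alpha> \<beta> by (intro consumption_small_before[of t "t + s" "T + 1" "\<beta> / 2" \<beta>]) auto
  note c_small = this
  \<comment> \<open>After the last time at which the capital is at least \<open>m\<close>, output is nonnegative.\<close>
  let ?S = "{v \<in> {0..t}. m \<le> kc v}"
  have "closed ?S"
    by (intro continuous_on_closed_Collect_le continuous_on_const continuous_on_subset[OF cont]) auto
  then have "compact ({0..t} \<inter> ?S)" by (intro compact_Int_closed compact_Icc)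
  moreover have "{0..t} \<inter> ?S = ?S" by auto
  moreover have "0 \<in> ?S" using t m yc by (simp add: kc_def)
  ultimately obtain t0 where t0: "t0 \<in> ?S" "\<And>v. v \<in> ?S \<Longrightarrow> v \<le> t0"
    using compact_attains_sup[of ?S] by auto
  have "- \<alpha> * (t - t0) \<le> primitive (\<lambda>s. y s - c s) t - primitive (\<lambda>s. y s - c s) t0"
  proof (rule primitive_increment_ge[OF yc])
    show "AE v in lborel. t0 < v \<and> v \<le> t \<longrightarrow> - \<alpha> \<le> y v - c v"
      using y_eq c_small
    proof eventually_elim
      case (elim v)
      show ?case
      proof
        assume v: "t0 < v \<and> v \<le> t"
        with t0(1) have "0 \<le> v" by auto
        have "v \<notin> ?S" using t0(2)[of v] v by linarith
        with v \<open>0 \<le> v\<close> have "kc v < m" by auto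
        then have "kc v < k1" using m by simp
        then have "0 \<le> f (kc v) (K v)" using f_nonneg K kc_nonneg \<open>0 \<le> v\<close> by auto
        with elim v \<open>0 \<le> v\<close> show "- \<alpha> \<le> y v - c v" by auto
      qed
    qed
  qed (use t0 in auto)
  moreover have "\<alpha> * (t - t0) \<le> \<alpha> * T" using t0(1) t \<alpha>(1) by (intro mult_left_mono) auto
  moreover have "m \<le> kc t0" using t0(1) by simp
  ultimately have "m - m / 2 \<le> kc t" using m(3) by (simp add: kc_def)
  with less m(4) show False by simp
qed

text \<open>
  Consuming a fraction of the capital stock: by concavity and \<open>f 0 L = 0\<close>, for every nondecreasing \<open>\<theta>\<close>
  with values in \<open>[0,1]\<close> the pair \<open>((1 - \<theta>) k, (1 - \<theta>) c + \<theta>' k)\<close> is feasible.  It loses at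
  most the fraction \<open>\<theta>(\<infinity>)\<close> of the total value, which is at most \<open>J_max\<close>.  If \<open>\<theta>\<close> grows at the rate \<open>\<epsilon>\<close>
  exactly while \<open>c \<le> \<beta>\<close>, the utility rate then rises by a multiple of \<open>\<epsilon> \<kappa> right_deriv U (2 * \<beta>)\<close>, so that
  this marginal utility cannot exceed a multiple of \<open>J_max / \<kappa>\<close>.
\<close>

lemma consumption_bounded_below:
  assumes T: "0 < T" and \<kappa>: "0 < \<kappa>"
    and y: "L1_loc y" "AE t in lborel. 0 \<le> t \<longrightarrow> y t = f (k t) (K t)"
    and k: "AE t in lborel. 0 \<le> t \<longrightarrow> k t = k0 + primitive (\<lambda>s. y s - c s) t"
    and \<kappa>_le: "\<And>t. \<lbrakk>0 \<le> t; t \<le> T\<rbrakk> \<Longrightarrow> \<kappa> \<le> k0 + primitive (\<lambda>s. y s - c s) t"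
    and \<beta>: "0 < \<beta>" "2 * exp (r * T) * J_max / \<kappa> < right_deriv U (2 * \<beta>)"
  shows "AE t in lborel. 0 \<le> t \<and> t \<le> T \<longrightarrow> \<beta> < c t"
proof -
  have [measurable]: "c \<in> borel_measurable borel" using c by (simp add: L1_loc_def)
  define kc where "kc = (\<lambda>t. k0 + primitive (\<lambda>s. y s - c s) t)"
  have yc: "L1_loc (\<lambda>s. y s - c s)" by (intro L1_loc_diff y c)
  have cont: "continuous_on {0..} kc"
    unfolding kc_def by (intro continuous_intros continuous_on_primitive yc)
  have kc_L1: "L1_loc kc" unfolding kc_def by (intro L1_loc_add L1_loc_const L1_loc_primitive yc)
  have k_eq: "AE t in lborel. 0 \<le> t \<longrightarrow> k t = kc t" using k by (simp add: kc_def)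
  have "AE t in lborel. 0 \<le> t \<longrightarrow> 0 \<le> kc t" using k_eq k_nonneg by eventually_elim auto
  then have kc_nonneg: "0 \<le> kc t" if "0 \<le> t" for t using continuous_AE_nonneg[OF cont _ that] by blast
  have y_eq: "AE t in lborel. 0 \<le> t \<longrightarrow> y t = f (kc t) (K t)" using y(2) k_eq by eventually_elim auto
  let ?B = "{t \<in> {0..T}. c t \<le> \<beta>}"
  have "\<not> 0 < measure lborel ?B"
  proof
    assume B_pos: "0 < measure lborel ?B"
    have B: "?B \<in> sets borel" "?B \<subseteq> {0..T}" by auto
    define mB where "mB = measure lborel ?B"
    have mB: "0 < mB" using B_pos by (simp add: mB_def)
    \<comment> \<open>The first term keeps \<open>\<theta> \<le> 1 / 2\<close>, the second keeps the increment \<open>\<epsilon> \<kappa>\<close> below \<open>\<beta>\<close>.\<close>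
    define \<epsilon> where "\<epsilon> = min (1 / (2 * mB)) (\<beta> / \<kappa>)"
    have \<epsilon>: "0 < \<epsilon>" using mB \<beta> \<kappa> by (simp add: \<epsilon>_def)
    have "\<epsilon> \<le> 1 / (2 * mB)" "\<epsilon> \<le> \<beta> / \<kappa>" by (auto simp: \<epsilon>_def)
    then have \<epsilon>_mB: "\<epsilon> * mB \<le> 1 / 2" and \<epsilon>_\<kappa>: "\<epsilon> * \<kappa> \<le> \<beta>" using mB \<kappa> by (auto simp: field_simps)
    define \<theta> where "\<theta> = (\<lambda>t. \<epsilon> * primitive (indicat_real ?B) t)"
    have \<theta>: "0 \<le> \<theta> t" "\<theta> t \<le> \<epsilon> * mB" for t
    proof -
      have "measure lborel (?B \<inter> {0..t}) \<le> mB"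
        unfolding mB_def
      proof (rule measure_mono_fmeasurable)
        show "?B \<in> fmeasurable lborel"
          using integrable_indicator_subset_Icc[OF B] by (simp add: fmeasurable_def integrable_indicator_iff)
      qed auto
      then show "\<theta> t \<le> \<epsilon> * mB" "0 \<le> \<theta> t"
        unfolding \<theta>_def primitive_indicator(1)[OF B(1)] using \<epsilon> by (auto intro!: mult_left_mono)
    qed
    have \<theta>_le: "\<theta> t \<le> 1 / 2" for t using \<theta>(2)[of t] \<epsilon>_mB by linarith
    let ?c = "\<lambda>t. (1 - \<theta> t) * c t + (\<epsilon> * indicat_real ?B t) * kc t"
    let ?g = "\<lambda>t. (1 - \<theta> t) * (y t - c t) - (\<epsilon> * indicat_real ?B t) * kc t"
    have \<theta>_meas: "(\<lambda>t. 1 - \<theta> t) \<in> borel_measurable borel"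
      unfolding \<theta>_def using primitive_indicator(2)[OF B(1)] by measurable
    have scaled: "L1_loc (\<lambda>t. (1 - \<theta> t) * u t)" if "L1_loc u" for u
    proof (rule L1_loc_mult_bounded[OF that \<theta>_meas])
      have "\<bar>1 - \<theta> t\<bar> \<le> 1" for t using \<theta>(1)[of t] \<theta>_le[of t] by linarith
      then show "\<exists>b. \<forall>t\<in>{0..R}. \<bar>1 - \<theta> t\<bar> \<le> b" for R by blast
    qed
    have localized: "L1_loc (\<lambda>t. (\<epsilon> * indicat_real ?B t) * kc t)"
    proof (rule L1_loc_mult_bounded[OF kc_L1])
      show "\<exists>b. \<forall>t\<in>{0..R}. \<bar>\<epsilon> * indicat_real ?B t\<bar> \<le> b" for R
        using \<epsilon> by (intro exI[of _ \<epsilon>]) (auto simp: indicator_def)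
    qed measurable
    have c': "L1_loc ?c" by (intro L1_loc_add scaled localized c)
    have g: "L1_loc ?g" by (intro L1_loc_diff scaled localized y c)
    have c'_nonneg: "AE t in lborel. 0 \<le> t \<longrightarrow> 0 \<le> ?c t"
      using c_nonneg
    proof eventually_elim
      case (elim t)
      then show ?case using \<theta>_le[of t] kc_nonneg[of t] \<epsilon> by (auto intro!: add_nonneg_nonneg mult_nonneg_nonneg)
    qed
    \<comment> \<open>\<open>1 - \<theta>\<close> and \<open>kc\<close> are both indefinite integrals.\<close>
    have k_scaled: "k0 + primitive ?g t = (1 - \<theta> t) * kc t" if t: "0 \<le> t" for t
    proof -
      have \<theta>_eq: "1 + primitive (\<lambda>s. - \<epsilon> * indicat_real ?B s) s = 1 - \<theta> s" for s
        unfolding primitive_cmult \<theta>_def by simp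
      have "(1 - \<theta> t) * kc t =
          1 * k0 + primitive (\<lambda>s. (1 - \<theta> s) * (y s - c s) + kc s * (- \<epsilon> * indicat_real ?B s)) t"
        using primitive_product_rule[OF L1_loc_cmult[OF primitive_indicator(2)[OF B(1)]] yc t, of 1 "- \<epsilon>" k0]
        unfolding \<theta>_eq kc_def .
      also have "primitive (\<lambda>s. (1 - \<theta> s) * (y s - c s) + kc s * (- \<epsilon> * indicat_real ?B s)) t = primitive ?g t"
        by (rule primitive_cong) simp
      finally show ?thesis by simp
    qed
    have adm: "(\<lambda>t. k0 + primitive ?g t, measure_of_density ?c) \<in> admissible f K k0"
    proof (rule admissibleI[OF g c' c'_nonneg])
      show "AE t in lborel. 0 \<le> t \<longrightarrow> 0 \<le> k0 + primitive ?g t"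
      proof (intro AE_I2 impI)
        fix t :: real assume t: "0 \<le> t"
        have "0 \<le> 1 - \<theta> t" using \<theta>_le[of t] by linarith
        then show "0 \<le> k0 + primitive ?g t"
          unfolding k_scaled[OF t] by (rule mult_nonneg_nonneg[OF _ kc_nonneg[OF t]])
      qed
      show "AE t in lborel. 0 \<le> t \<longrightarrow> ?g t + ?c t \<le> f (k0 + primitive ?g t) (K t)"
        using y_eq
      proof eventually_elim
        case (elim t)
        show ?case
        proof
          assume t: "0 \<le> t"
          have "?g t + ?c t = (1 - \<theta> t) * f (kc t) (K t)" using elim t by (simp add: algebra_simps)
          also have "\<dots> \<le> f ((1 - \<theta> t) * kc t) (K t)"
            using \<theta>(1)[of t] \<theta>_le[of t] by (intro f_scale K t kc_nonneg) auto
          finally show "?g t + ?c t \<le> f (k0 + primitive ?g t) (K t)" unfolding k_scaled[OF t] .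
        qed
      qed
    qed
    define d where "d = exp (- r * T) * (\<epsilon> * \<kappa> * right_deriv U (2 * \<beta>)) / 2"
    have D: "0 < right_deriv U (2 * \<beta>)" using right_deriv_utility_pos[OF utility, of "2 * \<beta>"] \<beta>(1) by simp
    let ?h = "\<lambda>t. exp (- r * t) * U (max 0 (c t))"
    let ?G = "\<lambda>t. d * indicat_real ?B t - (\<epsilon> * mB) * ?h t"
    have G_eq: "(\<lambda>t. indicator {0..} t * ?G t) = (\<lambda>t. d * indicat_real ?B t - (\<epsilon> * mB) * (indicator {0..} t * ?h t))"
      by (auto simp: indicator_def fun_eq_iff)
    have "(LBINT t. indicator {0..} t * ?G t) \<le> 0"
    proof (rule no_profitable_deviation[OF adm c' c'_nonneg])
      show "integrable lborel (\<lambda>t. indicator {0..} t * ?G t)"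
        unfolding G_eq
        by (intro Bochner_Integration.integrable_diff integrable_mult_right
            discounted_utility_integrable integrable_indicator_subset_Icc[OF B])
      show "AE t in lborel. 0 \<le> t \<longrightarrow> exp (- r * t) * U (c t) + ?G t \<le> exp (- r * t) * U (?c t)"
        using c_nonneg
      proof eventually_elim
        case (elim t)
        show ?case
        proof
          assume t: "0 \<le> t"
          with elim have ct: "0 \<le> c t" by simp
          then have Uc: "0 \<le> U (c t)" by (rule utility_nonneg[OF utility])
          have th: "0 \<le> 1 - \<theta> t" "1 / 2 \<le> 1 - \<theta> t" "1 - \<theta> t \<le> 1" using \<theta>(1)[of t] \<theta>_le[of t] by auto
          have "\<theta> t * U (c t) \<le> \<epsilon> * mB * U (c t)" using \<theta>(2)[of t] Uc by (intro mult_right_mono)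
          then have scale: "U (c t) - \<epsilon> * mB * U (c t) \<le> (1 - \<theta> t) * U (c t)" by (simp add: algebra_simps)
          show "exp (- r * t) * U (c t) + ?G t \<le> exp (- r * t) * U (?c t)"
          proof (cases "t \<in> ?B")
            case True
            let ?gain = "\<epsilon> * \<kappa> * right_deriv U (2 * \<beta>)"
            have gain: "0 \<le> ?gain" using \<epsilon> \<kappa> D by simp
            have "?gain \<le> U (c t + \<epsilon> * \<kappa>) - U (c t)"
              using True ct \<beta> \<epsilon> \<kappa> \<epsilon>_\<kappa> by (intro utility_gain[OF utility]) auto
            then have "(1 - \<theta> t) * ?gain \<le> (1 - \<theta> t) * (U (c t + \<epsilon> * \<kappa>) - U (c t))"
              using th by (intro mult_left_mono) auto
            moreover have "1 / 2 * ?gain \<le> (1 - \<theta> t) * ?gain" using th gain by (intro mult_right_mono) auto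
            moreover have "(1 - \<theta> t) * U (c t + \<epsilon> * \<kappa>) \<le> U ((1 - \<theta> t) * (c t + \<epsilon> * \<kappa>))"
              using \<theta>(1)[of t] \<theta>_le[of t] ct \<epsilon> \<kappa> by (intro utility_scale[OF utility]) auto
            moreover have "U ((1 - \<theta> t) * (c t + \<epsilon> * \<kappa>)) \<le> U (?c t)"
            proof (rule utility_mono[OF utility])
              show "0 \<le> (1 - \<theta> t) * (c t + \<epsilon> * \<kappa>)" using th ct \<epsilon> \<kappa> by simp
              have "(1 - \<theta> t) * (\<epsilon> * \<kappa>) \<le> 1 * (\<epsilon> * kc t)"
                using th \<epsilon> \<kappa> \<kappa>_le[of t] True by (intro mult_mono) (auto simp: kc_def)
              then show "(1 - \<theta> t) * (c t + \<epsilon> * \<kappa>) \<le> ?c t" using True by (simp add: algebra_simps)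
            qed
            ultimately have "U (c t) - \<epsilon> * mB * U (c t) + ?gain / 2 \<le> U (?c t)"
              using scale by (simp add: right_diff_distrib)
            then have "exp (- r * t) * (U (c t) - \<epsilon> * mB * U (c t) + ?gain / 2) \<le> exp (- r * t) * U (?c t)"
              by (intro mult_left_mono) auto
            moreover have "r * t \<le> r * T" using True r by (intro mult_left_mono) auto
            then have "d \<le> exp (- r * t) * (?gain / 2)"
              unfolding d_def times_divide_eq_right[symmetric] using gain by (intro mult_right_mono) auto
            ultimately show ?thesis using True ct by (simp add: algebra_simps)
          next
            case False
            have "U (c t) - \<epsilon> * mB * U (c t) \<le> U ((1 - \<theta> t) * c t)"
              using scale utility_scale[OF utility, of "\<theta> t" "c t"] \<theta>(1)[of t] \<theta>_le[of t] ct by linarith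
            also have "(1 - \<theta> t) * c t = ?c t" using False by simp
            finally have "exp (- r * t) * (U (c t) - \<epsilon> * mB * U (c t)) \<le> exp (- r * t) * U (?c t)"
              by (intro mult_left_mono) auto
            then show ?thesis using False ct by (simp add: algebra_simps)
          qed
        qed
      qed
    qed
    also have "(LBINT t. indicator {0..} t * ?G t) = d * mB - (\<epsilon> * mB) * (LBINT t. indicator {0..} t * ?h t)"
      unfolding G_eq using discounted_utility_integrable integrable_indicator_subset_Icc[OF B] by (simp add: mB_def)
    finally have "d * mB \<le> (\<epsilon> * mB) * (LBINT t. indicator {0..} t * ?h t)" by simp
    also have "\<dots> \<le> (\<epsilon> * mB) * J_max" using \<epsilon> mB by (intro mult_left_mono discounted_utility_le) auto
    finally have "(\<epsilon> * mB) * (exp (- r * T) * (\<kappa> * right_deriv U (2 * \<beta>)) / 2) \<le> (\<epsilon> * mB) * J_max"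
      by (simp add: d_def mult_ac)
    moreover have "0 < \<epsilon> * mB" using \<epsilon> mB by simp
    ultimately have "exp (- r * T) * (\<kappa> * right_deriv U (2 * \<beta>)) / 2 \<le> J_max"
      by (simp only: mult_le_cancel_left_pos)
    then have "exp (r * T) * (exp (- r * T) * (\<kappa> * right_deriv U (2 * \<beta>))) \<le> exp (r * T) * (2 * J_max)"
      by (intro mult_left_mono) auto
    moreover have "exp (r * T) * exp (- r * T) = 1" by (simp flip: exp_add)
    then have "exp (r * T) * (exp (- r * T) * (\<kappa> * right_deriv U (2 * \<beta>))) = \<kappa> * right_deriv U (2 * \<beta>)"
      by (simp only: mult.assoc[symmetric] mult_1)
    ultimately have "right_deriv U (2 * \<beta>) * \<kappa> \<le> 2 * exp (r * T) * J_max"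
      by (simp only: mult_ac)
    moreover have "2 * exp (r * T) * J_max < right_deriv U (2 * \<beta>) * \<kappa>"
      using \<beta>(2) \<kappa> by (simp only: pos_divide_less_eq)
    ultimately show False by linarith
  qed
  then have "AE t in lborel. t \<notin> ?B" by (intro AE_notin_of_measure_zero[of _ 0 T]) auto
  then show ?thesis by eventually_elim auto
qed

end

text \<open>
  \<open>f_lower\<close> integrates the bound on the marginal productivity, with continuity at \<open>x = 0\<close>; the uniform bounds
  come from compactness in \<open>(x, L)\<close>.
\<close>

lemma growth_model_constants:
  assumes I: "I \<subseteq> {0..}" and f: "net_output I f" and U: "utility U" and r: "0 < r" and k0: "0 < k0"
  shows "\<exists>\<delta> F k1. growth_model f U I r k0 M \<delta> F k1"
proof -
  have cont: "continuous_on ({0..} \<times> {0..}) (\<lambda>(x, L). f x L)" and f0: "\<And>L. L \<in> I \<Longrightarrow> f 0 L = 0"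
    and diff: "\<And>x L. 0 < x \<Longrightarrow> 0 < L \<Longrightarrow> (\<lambda>x. f x L) differentiable (at x)"
    and concave: "\<And>L. L \<in> I \<Longrightarrow> strictly_concave_on {0..} (\<lambda>x. f x L)"
    using f by (auto simp: net_output_def)
  obtain \<delta> where \<delta>: "0 < \<delta>" "\<And>x L. 0 < x \<Longrightarrow> 0 < L \<Longrightarrow> - \<delta> \<le> partial_k f x L"
    using f by (auto simp: net_output_def)
  obtain kbar where kbar: "\<And>M x L. 0 \<le> L \<Longrightarrow> L \<le> M \<Longrightarrow> 0 \<le> x \<Longrightarrow> kbar M \<le> (x::real) \<Longrightarrow> f x L \<le> (0::real)"
    using f unfolding net_output_def by meson
  obtain k1 where k1: "0 < k1" "\<And>x L. L \<in> I \<Longrightarrow> 0 < x \<Longrightarrow> x < k1 \<Longrightarrow> 0 < f x L"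
    using f by (auto simp: net_output_def)
  have "compact ((\<lambda>(x, L). f x L) ` ({0..kbar M} \<times> {0..M}))"
    by (intro compact_continuous_image compact_Times compact_Icc continuous_on_subset[OF cont]) auto
  then obtain B where B: "\<forall>x\<in>{0..kbar M}. \<forall>L\<in>{0..M}. \<bar>f x L\<bar> \<le> B"
    by (auto dest!: compact_imp_bounded simp: bounded_iff)
  have "growth_model f U I r k0 M \<delta> (max 0 B) k1"
  proof
    fix L x h :: real
    assume L: "L \<in> I" "0 < L" and x: "0 \<le> x" "0 \<le> h"
    have "f x L + \<delta> * x \<le> f (x + h) L + \<delta> * (x + h)"
    proof (rule DERIV_nonneg_imp_increasing_open[of x "x + h" "\<lambda>u. f u L + \<delta> * u"])
      fix u assume "x < u" "u < x + h"
      then have u: "0 < u" using x by simp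
      have "((\<lambda>u. f u L) has_real_derivative partial_k f u L) (at u)"
        unfolding partial_k_def using diff[OF u L(2)] by (simp add: DERIV_deriv_iff_real_differentiable)
      then have "((\<lambda>u. f u L + \<delta> * u) has_real_derivative partial_k f u L + \<delta> * 1) (at u)"
        by (intro DERIV_add DERIV_cmult DERIV_ident)
      then show "\<exists>d. ((\<lambda>u. f u L + \<delta> * u) has_real_derivative d) (at u) \<and> 0 \<le> d"
        using \<delta>(2)[OF u L(2)] by (intro exI[of _ "partial_k f u L + \<delta> * 1"]) auto
    next
      have "continuous_on {x..x + h} (\<lambda>u. (\<lambda>(x, L). f x L) (u, L))"
        by (rule continuous_on_compose2[OF cont]) (use x L in \<open>auto intro!: continuous_intros\<close>)
      then show "continuous_on {x..x + h} (\<lambda>u. f u L + \<delta> * u)" by (auto intro!: continuous_intros)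
    qed (use x in auto)
    then show "f x L - \<delta> * h \<le> f (x + h) L" by (simp add: algebra_simps)
  next
    fix L x assume "L \<in> I" "L \<le> M" "0 \<le> (x::real)"
    then show "f x L \<le> max 0 B"
      using kbar[of L M x] B I by (cases "kbar M \<le> x") force+
  next
    fix L \<theta> x :: real assume L: "L \<in> I" and \<theta>: "0 \<le> \<theta>" "\<theta> \<le> 1" and x: "0 \<le> x"
    show "(1 - \<theta>) * f x L \<le> f ((1 - \<theta>) * x) L"
    proof (cases "x = 0 \<or> \<theta> = 0 \<or> \<theta> = 1")
      case True
      then show ?thesis using f0[OF L] by auto
    next
      case False
      then have "(1 - \<theta>) * f x L + (1 - (1 - \<theta>)) * f 0 L < f ((1 - \<theta>) * x + (1 - (1 - \<theta>)) * 0) L"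
        using concave[OF L] \<theta> x unfolding strictly_concave_on_def
        by (elim conjE, elim ballE[of _ _ x] ballE[of _ _ 0] allE[of _ "1 - \<theta>"]) auto
      then show ?thesis using f0[OF L] by simp
    qed
  next
    fix L x :: real assume "L \<in> I" "0 \<le> x" "x < k1"
    then show "0 \<le> f x L" using k1(2)[of L x] f0[of L] by (cases "x = 0") auto
  next
    fix \<eta> :: real assume "0 < \<eta>"
    have "uniformly_continuous_on ({0..1} \<times> {0..M}) (\<lambda>(x, L). f x L)"
      by (intro compact_uniformly_continuous compact_Times compact_Icc continuous_on_subset[OF cont]) auto
    then obtain d where d: "0 < d" "\<And>z z'. \<lbrakk>z \<in> {0..1} \<times> {0..M}; z' \<in> {0..1} \<times> {0..M}; dist z' z < d\<rbrakk>
        \<Longrightarrow> dist (case z' of (x, L) \<Rightarrow> f x L) (case z of (x, L) \<Rightarrow> f x L) < \<eta>"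
      using \<open>0 < \<eta>\<close> unfolding uniformly_continuous_on_def by meson
    have "f x L \<le> \<eta>" if "L \<in> I" "L \<le> M" "0 \<le> x" "x \<le> min 1 (d / 2)" for L x
    proof -
      have "dist (f x L) (f 0 L) < \<eta>"
        using d(2)[of "(0, L)" "(x, L)"] that I d(1) by (auto simp: dist_prod_def)
      then show ?thesis using f0[OF that(1)] by (simp add: dist_real_def)
    qed
    then show "\<exists>x0>0. \<forall>L x. L \<in> I \<and> L \<le> M \<and> 0 \<le> x \<and> x \<le> x0 \<longrightarrow> f x L \<le> \<eta>"
      using d(1) by (intro exI[of _ "min 1 (d / 2)"]) auto
  qed (use assms \<delta>(1) k1(1) cont f0 in auto)
  then show ?thesis by blast
qed

theorem proposition3p6:
  fixes f :: "real \<Rightarrow> real \<Rightarrow> real" and U :: "real \<Rightarrow> real" and I :: "real set"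
    and r k0 :: real
  assumes "is_interval I" and "I \<subseteq> {0..}"
    and "net_output I f" and "utility U" and "0 < r" and "0 < k0"
  shows "\<forall>T>0. \<forall>M. \<exists>c_lo c_hi. 0 < c_lo \<and> c_lo < c_hi \<and>
    (\<forall>K k c :: real \<Rightarrow> real.
       K \<in> borel_measurable (lebesgue_on {0..}) \<and>
       (\<forall>t\<ge>0. 0 < K t \<and> K t \<in> I \<and> K t \<le> M) \<and>
       L1_loc c \<and> (AE t in lborel. 0 \<le> t \<longrightarrow> 0 \<le> c t) \<and>
       optimal_pair f U r K k0 k (measure_of_density c) \<longrightarrow>
       (AE t in lborel. 0 \<le> t \<and> t \<le> T \<longrightarrow> c_lo \<le> c t \<and> c t \<le> c_hi))"
proof (intro allI impI)
  fix T M :: real assume T: "0 < T"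
  obtain \<delta> F k1 where "growth_model f U I r k0 M \<delta> F k1"
    using growth_model_constants[OF assms(2-6)] by blast
  then interpret growth_model f U I r k0 M \<delta> F k1 .
  note D_pos = right_deriv_utility_pos[OF utility]
  \<comment> \<open>The Euler inequality is used on the horizon \<open>T + 1\<close>.\<close>
  define E where "E = exp (- (r + \<delta>) * (T + 1))"
  have E: "0 < E" by (simp add: E_def)
  have "0 < k0 + F * (T + 1) + 1" using k0 F T by (simp add: add_pos_nonneg)
  then have "0 < E * right_deriv U (2 * (k0 + F * (T + 1) + 1))" using D_pos E by simp
  then obtain a where a: "0 < a" "right_deriv U (a / 2) < E * right_deriv U (2 * (k0 + F * (T + 1) + 1))"
    using marginal_utility_at_top[OF utility] by blast
  \<comment> \<open>A consumption below \<open>\<alpha>\<close> uses up at most half of \<open>min k0 k1\<close> by the time \<open>T\<close>.\<close>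
  define \<alpha> where "\<alpha> = min k0 k1 / (2 * T)"
  have \<alpha>: "0 < \<alpha>" "\<alpha> * T \<le> min k0 k1 / 2" using k0 k1 T by (auto simp: \<alpha>_def)
  obtain b where b: "0 < b" "right_deriv U (\<alpha> / 2) / E < right_deriv U (2 * b)"
    using marginal_utility_at_0[OF utility] by blast
  then have b2: "right_deriv U (\<alpha> / 2) < E * right_deriv U (2 * b)" using E by (simp add: divide_less_eq mult.commute)
  obtain x0 where x0: "0 < x0" "\<And>L x. \<lbrakk>L \<in> I; L \<le> M; 0 \<le> x; x \<le> x0\<rbrakk> \<Longrightarrow> f x L \<le> b / 4"
    using f_small[of "b / 4"] b(1) by auto
  \<comment> \<open>After a time \<open>s\<close> with capital at most \<open>x0 / 2\<close> at the start, capital is still at most \<open>x0\<close>.\<close>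
  define s where "s = min 1 (x0 / (2 * (F + 1)))"
  have s: "0 < s" "s \<le> 1" "s \<le> x0 / (2 * (F + 1))" using x0 F by (auto simp: s_def)
  have "F * s \<le> (F + 1) * (x0 / (2 * (F + 1)))" using s F by (intro mult_mono) auto
  also have "\<dots> = x0 / 2" using F by (simp add: field_simps)
  finally have s4: "F * s \<le> x0 / 2" .
  define \<kappa> where "\<kappa> = min (min k0 k1 / 2) (min (x0 / 2) (s * b / 4))"
  have \<kappa>: "0 < \<kappa>" "\<kappa> \<le> min k0 k1 / 2" "\<kappa> \<le> x0 / 2" "\<kappa> \<le> s * b / 4"
    using k0 k1 x0 s b unfolding \<kappa>_def by (simp, auto intro: min.coboundedI1 min.coboundedI2)
  obtain d where d: "0 < d" "2 * exp (r * T) * J_max / \<kappa> < right_deriv U (2 * d)"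
    using marginal_utility_at_0[OF utility] by blast
  show "\<exists>c_lo c_hi. 0 < c_lo \<and> c_lo < c_hi \<and>
    (\<forall>K k c :: real \<Rightarrow> real.
       K \<in> borel_measurable (lebesgue_on {0..}) \<and>
       (\<forall>t\<ge>0. 0 < K t \<and> K t \<in> I \<and> K t \<le> M) \<and>
       L1_loc c \<and> (AE t in lborel. 0 \<le> t \<longrightarrow> 0 \<le> c t) \<and>
       optimal_pair f U r K k0 k (measure_of_density c) \<longrightarrow>
       (AE t in lborel. 0 \<le> t \<and> t \<le> T \<longrightarrow> c_lo \<le> c t \<and> c t \<le> c_hi))"
  proof (rule exI[of _ d], rule exI[of _ "max a (d + 1)"], intro conjI allI impI)
    fix K k c :: "real \<Rightarrow> real"
    assume "K \<in> borel_measurable (lebesgue_on {0..}) \<and>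
       (\<forall>t\<ge>0. 0 < K t \<and> K t \<in> I \<and> K t \<le> M) \<and>
       L1_loc c \<and> (AE t in lborel. 0 \<le> t \<longrightarrow> 0 \<le> c t) \<and>
       optimal_pair f U r K k0 k (measure_of_density c)"
    then interpret optimum f U I r k0 M \<delta> F k1 K k c
      by unfold_locales auto
    obtain y where y: "L1_loc y" "AE t in lborel. 0 \<le> t \<longrightarrow> y t = f (k t) (K t)"
      and k: "AE t in lborel. 0 \<le> t \<longrightarrow> k t = k0 + primitive (\<lambda>s. y s - c s) t"
      by (rule no_waste)
    have "AE t in lborel. 0 \<le> t \<and> t \<le> T \<longrightarrow> d < c t"
      by (rule consumption_bounded_below[OF T \<kappa>(1) y k _ d])
        (rule capital_bounded_below[OF T \<alpha> b(1) b2[unfolded E_def] x0 s(1,2) s4 \<kappa>(2-4) y k])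
    moreover have "AE t in lborel. 0 \<le> t \<and> t \<le> T \<longrightarrow> c t < a"
      by (rule consumption_less[OF T a[unfolded E_def]])
    ultimately show "AE t in lborel. 0 \<le> t \<and> t \<le> T \<longrightarrow> d \<le> c t \<and> c t \<le> max a (d + 1)"
      by eventually_elim auto
  qed (use d in auto)
qed

end
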